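(* Let $\mathcal C$ be a $\mathbf k$-linear 2-Calabi--Yau triangulated category with a stability condition $\tau$. Let $X$ be a spherical $\tau$-stable object of $\mathcal C$, and assume that $X$ is (up to isomorphism) the unique $\tau$-stable object of its phase. Let $Y$ be any object of $\mathcal C$ such that $\operatorname{Hom}^i(Y,Y)=0$ for all $i<0$ and $\phi^+(Y)-\phi^-(Y)\ge 1$. Then: (1) If $\phi^-(Y)=\phi(X)$, then $\phi^+(Y)\ge\phi^+(\sigma_X^{-1}(Y))$. (2) If $\phi^+(Y)=\phi(X)$, then $\phi^-(Y)\le\phi^-(\sigma_X(Y))$.
   Context: $\mathbf k$ is a field. Write $\operatorname{Hom}^i(X,Y)=\operatorname{Hom}(X,Y[i])$ and $\operatorname{Hom}^*(X,Y)=\bigoplus_i\operatorname{Hom}^i(X,Y)$, which is assumed finite-dimensional. 2-Calabi--Yau means there are natural isomorphisms $\operatorname{Hom}^i(X,Y)\cong\operatorname{Hom}^{2-i}(Y,X)^\vee$. An object $X$ is spherical if $\operatorname{Hom}^*(X,X)\cong H^*(S^2,\mathbf k)$ as graded $\mathbf k$-algebras. A spherical object $X$ gives an auto-equivalence $\sigma_X$ of $\mathcal C$, the spherical twist, with exact triangles $$\operatorname{Hom}^*(X,Y)\otimes X\to Y\to\sigma_X(Y)\xrightarrow{+1},\qquad \sigma_X^{-1}(Y)\to Y\to X\otimes\operatorname{Hom}^*(Y,X)^\vee\xrightarrow{+1},$$ whose maps $\operatorname{Hom}^*(X,Y)\otimes X\to Y$ and $Y\to X\otimes \operatorname{Hom}^*(Y,X)^\vee$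 are evaluation and coevaluation. Stability conditions are in the sense of Bridgeland; $\phi(X)$ is the phase of a $\tau$-semistable object $X$. For an object $Y$ with Harder--Narasimhan factors $Z_1,\dots,Z_n$ of phases $\phi(Z_1)>\dots>\phi(Z_n)$, put $\phi^+(Y)=\phi(Z_1)$ and $\phi^-(Y)=\phi(Z_n)$. Objects to which $\phi^\pm$ is applied are understood to be nonzero.
   Formalization: The stability condition is additionally assumed to be locally finite (Bridgeland's condition for points of Stab); without it a semistable object of the phase of X may have no stable factors, and claim (1) fails. *)

theory Defs
  imports Complex_Main "HOL-Library.Product_Plus"
begin

section \<open>Linear categories\<close>

text \<open>
  The objects are the elements of the type \<open>'o\<close>. The morphism spaces \<open>Hom C X Y\<close> are subspaces of
  one ambient \<open>'k\<close>-vector space \<open>'m\<close>. This is no restriction on a small linear category: the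
  direct sum of all its morphism spaces can serve as \<open>'m\<close>. Composition and the arrow parts of
  functors need not be given meaning outside the morphism spaces, and no axiom constrains them there.

  The shift is a strict action of the integers: \<open>sh C n X\<close> is $X[n]$, and \<open>shm C n f\<close> is $f[n]$.
  \<open>dist C X Y Z f g h\<close> says that $X \to Y \to Z \to X[1]$, with maps \<open>f\<close>, \<open>g\<close>, \<open>h\<close>, is a
  distinguished triangle.
\<close>

record ('k, 'o, 'm) tricat =
  scal :: "'k \<Rightarrow> 'm \<Rightarrow> 'm"
  Hom  :: "'o \<Rightarrow> 'o \<Rightarrow> 'm set"
  cmp  :: "'m \<Rightarrow> 'm \<Rightarrow> 'm"  (infixr "\<cdot>\<index>" 70)
  idt  :: "'o \<Rightarrow> 'm"
  sh   :: "int \<Rightarrow> 'o \<Rightarrow> 'o"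
  shm  :: "int \<Rightarrow> 'm \<Rightarrow> 'm"
  dist :: "'o \<Rightarrow> 'o \<Rightarrow> 'o \<Rightarrow> 'm \<Rightarrow> 'm \<Rightarrow> 'm \<Rightarrow> bool"

locale klinear_category =
  fixes C :: "('k::field, 'o, 'm::ab_group_add) tricat"
  assumes vector_space_scal: "vector_space (scal C)"
    and subspace_Hom: "module.subspace (scal C) (Hom C X Y)"
    and idt_Hom: "idt C X \<in> Hom C X X"
    and cmp_Hom: "\<lbrakk>f \<in> Hom C X Y; g \<in> Hom C Y Z\<rbrakk> \<Longrightarrow> g \<cdot>\<^bsub>C\<^esub> f \<in> Hom C X Z"
    and cmp_idt_left: "f \<in> Hom C X Y \<Longrightarrow> idt C Y \<cdot>\<^bsub>C\<^esub> f = f"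
    and cmp_idt_right: "f \<in> Hom C X Y \<Longrightarrow> f \<cdot>\<^bsub>C\<^esub> idt C X = f"
    and cmp_assoc: "\<lbrakk>f \<in> Hom C W X; g \<in> Hom C X Y; h \<in> Hom C Y Z\<rbrakk>
      \<Longrightarrow> h \<cdot>\<^bsub>C\<^esub> (g \<cdot>\<^bsub>C\<^esub> f) = (h \<cdot>\<^bsub>C\<^esub> g) \<cdot>\<^bsub>C\<^esub> f"
    and cmp_add_left: "\<lbrakk>f \<in> Hom C X Y; g \<in> Hom C Y Z; g' \<in> Hom C Y Z\<rbrakk>
      \<Longrightarrow> (g + g') \<cdot>\<^bsub>C\<^esub> f = g \<cdot>\<^bsub>C\<^esub> f + g' \<cdot>\<^bsub>C\<^esub> f"
    and cmp_add_right: "\<lbrakk>f \<in> Hom C X Y; f' \<in> Hom C X Y; g \<in> Hom C Y Z\<rbrakk>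
      \<Longrightarrow> g \<cdot>\<^bsub>C\<^esub> (f + f') = g \<cdot>\<^bsub>C\<^esub> f + g \<cdot>\<^bsub>C\<^esub> f'"
    and cmp_scal_left: "\<lbrakk>f \<in> Hom C X Y; g \<in> Hom C Y Z\<rbrakk>
      \<Longrightarrow> scal C c g \<cdot>\<^bsub>C\<^esub> f = scal C c (g \<cdot>\<^bsub>C\<^esub> f)"
    and cmp_scal_right: "\<lbrakk>f \<in> Hom C X Y; g \<in> Hom C Y Z\<rbrakk>
      \<Longrightarrow> g \<cdot>\<^bsub>C\<^esub> scal C c f = scal C c (g \<cdot>\<^bsub>C\<^esub> f)"

definition is_iso :: "('k, 'o, 'm) tricat \<Rightarrow> 'o \<Rightarrow> 'o \<Rightarrow> 'm \<Rightarrow> bool" where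
  "is_iso C X Y f \<longleftrightarrow> f \<in> Hom C X Y \<and>
     (\<exists>g \<in> Hom C Y X. g \<cdot>\<^bsub>C\<^esub> f = idt C X \<and> f \<cdot>\<^bsub>C\<^esub> g = idt C Y)"

definition isomorphic :: "('k, 'o, 'm) tricat \<Rightarrow> 'o \<Rightarrow> 'o \<Rightarrow> bool" where
  "isomorphic C X Y \<longleftrightarrow> (\<exists>f. is_iso C X Y f)"

definition zero_object :: "('k, 'o, 'm::zero) tricat \<Rightarrow> 'o \<Rightarrow> bool" where
  "zero_object C Z \<longleftrightarrow> (\<forall>W. Hom C Z W = {0} \<and> Hom C W Z = {0})"

definition biproduct :: "('k, 'o, 'm::ab_group_add) tricat \<Rightarrow> 'i set \<Rightarrow> ('i \<Rightarrow> 'o) \<Rightarrow> 'o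
    \<Rightarrow> ('i \<Rightarrow> 'm) \<Rightarrow> ('i \<Rightarrow> 'm) \<Rightarrow> bool" where
  "biproduct C I F E \<iota> \<pi> \<longleftrightarrow> finite I \<and>
     (\<forall>i\<in>I. \<iota> i \<in> Hom C (F i) E \<and> \<pi> i \<in> Hom C E (F i)) \<and>
     (\<forall>i\<in>I. \<forall>j\<in>I. \<pi> j \<cdot>\<^bsub>C\<^esub> \<iota> i = (if i = j then idt C (F i) else 0)) \<and>
     (\<Sum>i\<in>I. \<iota> i \<cdot>\<^bsub>C\<^esub> \<pi> i) = idt C E"

section \<open>Triangulated categories\<close>

locale triangulated_category = klinear_category C
  for C :: "('k::field, 'o, 'm::ab_group_add) tricat" +
  assumes ex_zero_object: "\<exists>Z. zero_object C Z"
    and ex_biproduct: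
      "\<exists>E \<iota> \<pi>. biproduct C (UNIV :: bool set) (\<lambda>b. if b then X else Y) E \<iota> \<pi>"
    \<comment> \<open>the shift\<close>
    and sh_zero: "sh C 0 X = X"
    and sh_add: "sh C (m + n) X = sh C m (sh C n X)"
    and shm_Hom: "f \<in> Hom C X Y \<Longrightarrow> shm C n f \<in> Hom C (sh C n X) (sh C n Y)"
    and shm_zero: "f \<in> Hom C X Y \<Longrightarrow> shm C 0 f = f"
    and shm_plus: "f \<in> Hom C X Y \<Longrightarrow> shm C (m + n) f = shm C m (shm C n f)"
    and shm_idt: "shm C n (idt C X) = idt C (sh C n X)"
    and shm_cmp: "\<lbrakk>f \<in> Hom C X Y; g \<in> Hom C Y Z\<rbrakk>
      \<Longrightarrow> shm C n (g \<cdot>\<^bsub>C\<^esub> f) = shm C n g \<cdot>\<^bsub>C\<^esub> shm C n f"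
    and shm_add: "\<lbrakk>f \<in> Hom C X Y; g \<in> Hom C X Y\<rbrakk> \<Longrightarrow> shm C n (f + g) = shm C n f + shm C n g"
    and shm_scal: "f \<in> Hom C X Y \<Longrightarrow> shm C n (scal C c f) = scal C c (shm C n f)"
    \<comment> \<open>TR1\<close>
    and dist_Hom: "dist C X Y Z f g h
      \<Longrightarrow> f \<in> Hom C X Y \<and> g \<in> Hom C Y Z \<and> h \<in> Hom C Z (sh C 1 X)"
    and dist_idt: "zero_object C Z \<Longrightarrow> dist C X X Z (idt C X) 0 0"
    and dist_iso: "\<lbrakk>dist C X Y Z f g h;
        f' \<in> Hom C X' Y'; g' \<in> Hom C Y' Z'; h' \<in> Hom C Z' (sh C 1 X');
        is_iso C X X' u; is_iso C Y Y' v; is_iso C Z Z' w;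
        v \<cdot>\<^bsub>C\<^esub> f = f' \<cdot>\<^bsub>C\<^esub> u; w \<cdot>\<^bsub>C\<^esub> g = g' \<cdot>\<^bsub>C\<^esub> v; shm C 1 u \<cdot>\<^bsub>C\<^esub> h = h' \<cdot>\<^bsub>C\<^esub> w\<rbrakk>
      \<Longrightarrow> dist C X' Y' Z' f' g' h'"
    and ex_cone: "f \<in> Hom C X Y \<Longrightarrow> \<exists>Z g h. dist C X Y Z f g h"
    \<comment> \<open>TR2\<close>
    and dist_rotate: "\<lbrakk>f \<in> Hom C X Y; g \<in> Hom C Y Z; h \<in> Hom C Z (sh C 1 X)\<rbrakk>
      \<Longrightarrow> dist C X Y Z f g h \<longleftrightarrow> dist C Y Z (sh C 1 X) g h (- shm C 1 f)"
    \<comment> \<open>TR3\<close>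
    and dist_morphism: "\<lbrakk>dist C X Y Z f g h; dist C X' Y' Z' f' g' h';
        u \<in> Hom C X X'; v \<in> Hom C Y Y'; v \<cdot>\<^bsub>C\<^esub> f = f' \<cdot>\<^bsub>C\<^esub> u\<rbrakk>
      \<Longrightarrow> \<exists>w \<in> Hom C Z Z'. w \<cdot>\<^bsub>C\<^esub> g = g' \<cdot>\<^bsub>C\<^esub> v \<and> shm C 1 u \<cdot>\<^bsub>C\<^esub> h = h' \<cdot>\<^bsub>C\<^esub> w"
    \<comment> \<open>TR4\<close>
    and octahedral: "\<lbrakk>dist C X Y Z' f i i'; dist C Y Z X' g j j';
        dist C X Z Y' (g \<cdot>\<^bsub>C\<^esub> f) k k'\<rbrakk>
      \<Longrightarrow> \<exists>u v. dist C Z' Y' X' u v (shm C 1 i \<cdot>\<^bsub>C\<^esub> j') \<and>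
            u \<cdot>\<^bsub>C\<^esub> i = k \<cdot>\<^bsub>C\<^esub> g \<and> k' \<cdot>\<^bsub>C\<^esub> u = i' \<and>
            v \<cdot>\<^bsub>C\<^esub> k = j \<and> j' \<cdot>\<^bsub>C\<^esub> v = shm C 1 f \<cdot>\<^bsub>C\<^esub> k'"

abbreviation hom :: "('k, 'o, 'm) tricat \<Rightarrow> int \<Rightarrow> 'o \<Rightarrow> 'o \<Rightarrow> 'm set" where
  "hom C i X Y \<equiv> Hom C X (sh C i Y)"

definition hom_finite :: "('k::field, 'o, 'm::ab_group_add) tricat \<Rightarrow> bool" where
  "hom_finite C \<longleftrightarrow> (\<forall>X Y. finite {i. hom C i X Y \<noteq> {0}} \<and>
     (\<forall>i. \<exists>B. finite B \<and> module.span (scal C) B = hom C i X Y))"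

section \<open>The 2-Calabi--Yau property\<close>

text \<open>Functionals on a subspace \<open>V\<close> are normalised to vanish outside \<open>V\<close>.\<close>

definition dual :: "('k::field, 'o, 'm::ab_group_add) tricat \<Rightarrow> 'm set \<Rightarrow> ('m \<Rightarrow> 'k) set" where
  "dual C V = {l. (\<forall>v\<in>V. \<forall>w\<in>V. l (v + w) = l v + l w) \<and>
                  (\<forall>c. \<forall>v\<in>V. l (scal C c v) = c * l v) \<and> (\<forall>v. v \<notin> V \<longrightarrow> l v = 0)}"

text \<open>
  The last two conditions say that the isomorphism \<open>\<eta> i X Y\<close> from $\mathrm{Hom}^i(X,Y)$ to
  the dual of $\mathrm{Hom}^{2-i}(Y,X)$ is natural in \<open>X\<close> and in \<open>Y\<close>.
\<close>

definition two_calabi_yau :: "('k::field, 'o, 'm::ab_group_add) tricat \<Rightarrow> bool" where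
  "two_calabi_yau C \<longleftrightarrow> (\<exists>\<eta> :: int \<Rightarrow> 'o \<Rightarrow> 'o \<Rightarrow> 'm \<Rightarrow> 'm \<Rightarrow> 'k.
     (\<forall>i X Y. bij_betw (\<eta> i X Y) (hom C i X Y) (dual C (hom C (2 - i) Y X))) \<and>
     (\<forall>i X Y. \<forall>a \<in> hom C i X Y. \<forall>a' \<in> hom C i X Y. \<forall>b.
        \<eta> i X Y (a + a') b = \<eta> i X Y a b + \<eta> i X Y a' b) \<and>
     (\<forall>i X Y c. \<forall>a \<in> hom C i X Y. \<forall>b. \<eta> i X Y (scal C c a) b = c * \<eta> i X Y a b) \<and>
     (\<forall>i X X' Y. \<forall>f \<in> Hom C X' X. \<forall>a \<in> hom C i X Y. \<forall>b \<in> hom C (2 - i) Y X'.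
        \<eta> i X' Y (a \<cdot>\<^bsub>C\<^esub> f) b = \<eta> i X Y a (shm C (2 - i) f \<cdot>\<^bsub>C\<^esub> b)) \<and>
     (\<forall>i X Y Y'. \<forall>g \<in> Hom C Y Y'. \<forall>a \<in> hom C i X Y. \<forall>b \<in> hom C (2 - i) Y' X.
        \<eta> i X Y' (shm C i g \<cdot>\<^bsub>C\<^esub> a) b = \<eta> i X Y a (b \<cdot>\<^bsub>C\<^esub> g)))"

section \<open>Spherical objects\<close>

text \<open>A graded algebra, given by its homogeneous components and the products between them.\<close>

record ('k, 'a) graded_algebra =
  gr_scal :: "'k \<Rightarrow> 'a \<Rightarrow> 'a"
  gr_part :: "int \<Rightarrow> 'a set"
  gr_mult :: "int \<Rightarrow> int \<Rightarrow> 'a \<Rightarrow> 'a \<Rightarrow> 'a"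
  gr_one  :: "'a"

definition graded_algebra_isomorphic ::
    "('k, 'a::plus) graded_algebra \<Rightarrow> ('k, 'b::plus) graded_algebra \<Rightarrow> bool" where
  "graded_algebra_isomorphic A B \<longleftrightarrow> (\<exists>\<theta> :: int \<Rightarrow> 'a \<Rightarrow> 'b.
     (\<forall>i. bij_betw (\<theta> i) (gr_part A i) (gr_part B i)) \<and>
     (\<forall>i. \<forall>a \<in> gr_part A i. \<forall>a' \<in> gr_part A i. \<theta> i (a + a') = \<theta> i a + \<theta> i a') \<and>
     (\<forall>i c. \<forall>a \<in> gr_part A i. \<theta> i (gr_scal A c a) = gr_scal B c (\<theta> i a)) \<and>
     (\<forall>i j. \<forall>a \<in> gr_part A i. \<forall>b \<in> gr_part A j.
        \<theta> (i + j) (gr_mult A i j a b) = gr_mult B i j (\<theta> i a) (\<theta> j b)) \<and>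
     \<theta> 0 (gr_one A) = gr_one B)"

text \<open>
  For \<open>g\<close> of degree \<open>i\<close> and \<open>f\<close> of degree \<open>j\<close> the product is
  $X \xrightarrow{f} X[j] \xrightarrow{g[j]} X[i+j]$.
\<close>

definition End_algebra :: "('k, 'o, 'm) tricat \<Rightarrow> 'o \<Rightarrow> ('k, 'm) graded_algebra" where
  "End_algebra C X =
     \<lparr>gr_scal = scal C, gr_part = (\<lambda>i. hom C i X X),
      gr_mult = (\<lambda>i j g f. shm C j g \<cdot>\<^bsub>C\<^esub> f), gr_one = idt C X\<rparr>"

text \<open>
  $H^*(S^2,\mathbf k) = \mathbf k[t]/(t^2)$ with \<open>t\<close> of degree 2; the pair \<open>(a, b)\<close> is $a + bt$.
\<close>

definition cohomology_S2 :: "('k::field, 'k \<times> 'k) graded_algebra" where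
  "cohomology_S2 =
     \<lparr>gr_scal = (\<lambda>c (a, b). (c * a, c * b)),
      gr_part = (\<lambda>i. if i = 0 then range (\<lambda>a. (a, 0))
                     else if i = 2 then range (\<lambda>b. (0, b)) else {(0, 0)}),
      gr_mult = (\<lambda>i j (a, b) (c, d). (a * c, a * d + b * c)),
      gr_one = (1, 0)\<rparr>"

definition spherical :: "('k::field, 'o, 'm::ab_group_add) tricat \<Rightarrow> 'o \<Rightarrow> bool" where
  "spherical C X \<longleftrightarrow>
     graded_algebra_isomorphic (End_algebra C X) (cohomology_S2 :: ('k, 'k \<times> 'k) graded_algebra)"

section \<open>Spherical twists\<close>

record ('o, 'm) endofunctor =
  fobj :: "'o \<Rightarrow> 'o"
  farr :: "'m \<Rightarrow> 'm"

definition klinear_functor ::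
    "('k::field, 'o, 'm::ab_group_add) tricat \<Rightarrow> ('o, 'm) endofunctor \<Rightarrow> bool" where
  "klinear_functor C F \<longleftrightarrow>
     (\<forall>X Y. \<forall>f \<in> Hom C X Y. farr F f \<in> Hom C (fobj F X) (fobj F Y)) \<and>
     (\<forall>X. farr F (idt C X) = idt C (fobj F X)) \<and>
     (\<forall>X Y Z. \<forall>f \<in> Hom C X Y. \<forall>g \<in> Hom C Y Z. farr F (g \<cdot>\<^bsub>C\<^esub> f) = farr F g \<cdot>\<^bsub>C\<^esub> farr F f) \<and>
     (\<forall>X Y. \<forall>f \<in> Hom C X Y. \<forall>g \<in> Hom C X Y. farr F (f + g) = farr F f + farr F g) \<and>
     (\<forall>X Y c. \<forall>f \<in> Hom C X Y. farr F (scal C c f) = scal C c (farr F f))"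

definition natural_iso :: "('k, 'o, 'm) tricat \<Rightarrow> ('o, 'm) endofunctor \<Rightarrow> ('o, 'm) endofunctor
    \<Rightarrow> ('o \<Rightarrow> 'm) \<Rightarrow> bool" where
  "natural_iso C F G \<theta> \<longleftrightarrow> (\<forall>X. is_iso C (fobj F X) (fobj G X) (\<theta> X)) \<and>
     (\<forall>X Y. \<forall>f \<in> Hom C X Y. \<theta> Y \<cdot>\<^bsub>C\<^esub> farr F f = farr G f \<cdot>\<^bsub>C\<^esub> \<theta> X)"

definition id_functor :: "('o, 'm) endofunctor" where
  "id_functor = \<lparr>fobj = id, farr = id\<rparr>"

definition shift_functor :: "('k, 'o, 'm) tricat \<Rightarrow> ('o, 'm) endofunctor" where
  "shift_functor C = \<lparr>fobj = sh C 1, farr = shm C 1\<rparr>"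

definition comp_functor ::
    "('o, 'm) endofunctor \<Rightarrow> ('o, 'm) endofunctor \<Rightarrow> ('o, 'm) endofunctor" where
  "comp_functor G F = \<lparr>fobj = fobj G \<circ> fobj F, farr = farr G \<circ> farr F\<rparr>"

definition exact_functor ::
    "('k::field, 'o, 'm::ab_group_add) tricat \<Rightarrow> ('o, 'm) endofunctor \<Rightarrow> bool" where
  "exact_functor C F \<longleftrightarrow> klinear_functor C F \<and>
     (\<exists>\<xi>. natural_iso C (comp_functor F (shift_functor C)) (comp_functor (shift_functor C) F) \<xi> \<and>
        (\<forall>X Y Z f g h. dist C X Y Z f g h \<longrightarrow>
           dist C (fobj F X) (fobj F Y) (fobj F Z) (farr F f) (farr F g) (\<xi> X \<cdot>\<^bsub>C\<^esub> farr F h)))"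

definition autoequivalence :: "('k::field, 'o, 'm::ab_group_add) tricat
    \<Rightarrow> ('o, 'm) endofunctor \<Rightarrow> ('o, 'm) endofunctor \<Rightarrow> bool" where
  "autoequivalence C F G \<longleftrightarrow> exact_functor C F \<and> exact_functor C G \<and>
     (\<exists>\<theta>. natural_iso C (comp_functor G F) id_functor \<theta>) \<and>
     (\<exists>\<theta>. natural_iso C (comp_functor F G) id_functor \<theta>)"

definition is_basis :: "('k::field, 'o, 'm::ab_group_add) tricat \<Rightarrow> 'm set \<Rightarrow> 'm set \<Rightarrow> bool" where
  "is_basis C V B \<longleftrightarrow> \<not> module.dependent (scal C) B \<and> module.span (scal C) B = V"

text \<open>
  For a finite-dimensional graded space \<open>V\<close>, the object $V \otimes X$ is the direct sum of copies of
  $X[-i]$, one for each element of degree \<open>i\<close> of a homogeneous basis of \<open>V\<close>. On the summand of a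
  basis element $b : X \to Y[i]$ of $\mathrm{Hom}^*(X,Y)$, evaluation is $b[-i] : X[-i] \to Y$.
\<close>

definition evaluation :: "('k::field, 'o, 'm::ab_group_add) tricat \<Rightarrow> 'o \<Rightarrow> 'o \<Rightarrow> 'o \<Rightarrow> 'm \<Rightarrow> bool"
  where
  "evaluation C X Y E ev \<longleftrightarrow> (\<exists>B \<iota> \<pi>.
     (\<forall>i. is_basis C (hom C i X Y) (B i)) \<and>
     biproduct C (SIGMA i:UNIV. B i) (\<lambda>(i, b). sh C (- i) X) E \<iota> \<pi> \<and>
     ev \<in> Hom C E Y \<and> (\<forall>i. \<forall>b \<in> B i. ev \<cdot>\<^bsub>C\<^esub> \<iota> (i, b) = shm C (- i) b))"

text \<open>
  The dual of $\mathrm{Hom}^i(Y,X)$ has degree $-i$, so a basis element $b : Y \to X[i]$ of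
  $\mathrm{Hom}^*(Y,X)$ contributes (through the dual basis) a summand $X[i]$; the component of
  coevaluation there is \<open>b\<close>.
\<close>

definition coevaluation :: "('k::field, 'o, 'm::ab_group_add) tricat \<Rightarrow> 'o \<Rightarrow> 'o \<Rightarrow> 'o \<Rightarrow> 'm \<Rightarrow> bool"
  where
  "coevaluation C X Y E coev \<longleftrightarrow> (\<exists>B \<iota> \<pi>.
     (\<forall>i. is_basis C (hom C i Y X) (B i)) \<and>
     biproduct C (SIGMA i:UNIV. B i) (\<lambda>(i, b). sh C i X) E \<iota> \<pi> \<and>
     coev \<in> Hom C Y E \<and> (\<forall>i. \<forall>b \<in> B i. \<pi> (i, b) \<cdot>\<^bsub>C\<^esub> coev = b))"

text \<open>
  Cones are not functorial in a bare triangulated category, so the twist along \<open>X\<close> is not a function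
  of \<open>C\<close> and \<open>X\<close>. The predicate says that \<open>\<sigma>\<close> is such a twist, with quasi-inverse \<open>\<sigma>'\<close>.
\<close>

definition spherical_twist :: "('k::field, 'o, 'm::ab_group_add) tricat \<Rightarrow> 'o
    \<Rightarrow> ('o, 'm) endofunctor \<Rightarrow> ('o, 'm) endofunctor \<Rightarrow> bool" where
  "spherical_twist C X \<sigma> \<sigma>' \<longleftrightarrow> autoequivalence C \<sigma> \<sigma>' \<and>
     (\<forall>Y. \<exists>E ev q r. evaluation C X Y E ev \<and> dist C E Y (fobj \<sigma> Y) ev q r) \<and>
     (\<forall>Y. \<exists>E coev p r. coevaluation C X Y E coev \<and> dist C (fobj \<sigma>' Y) Y E p coev r)"

section \<open>Stability conditions\<close>

record 'o stability =
  slice  :: "real \<Rightarrow> 'o set"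
  charge :: "'o \<Rightarrow> complex"

text \<open>
  \<open>HN_filtration C P Y n E A \<psi>\<close>: the objects $0 = E_0, E_1, \dots, E_n = Y$ form a
  Harder--Narasimhan filtration of \<open>Y\<close>. Its factors \<open>A 0, \<dots>, A (n - 1)\<close> and phases \<open>\<psi>\<close> are indexed
  from 0.
\<close>

definition HN_filtration :: "('k, 'o, 'm::zero) tricat \<Rightarrow> (real \<Rightarrow> 'o set) \<Rightarrow> 'o \<Rightarrow> nat
    \<Rightarrow> (nat \<Rightarrow> 'o) \<Rightarrow> (nat \<Rightarrow> 'o) \<Rightarrow> (nat \<Rightarrow> real) \<Rightarrow> bool" where
  "HN_filtration C P Y n E A \<psi> \<longleftrightarrow> n > 0 \<and> zero_object C (E 0) \<and> E n = Y \<and>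
     (\<forall>j<n. \<exists>f g h. dist C (E j) (E (Suc j)) (A j) f g h) \<and>
     (\<forall>j<n. A j \<in> P (\<psi> j) \<and> \<not> zero_object C (A j)) \<and>
     (\<forall>i j. i < j \<and> j < n \<longrightarrow> \<psi> j < \<psi> i)"

definition slicing :: "('k::field, 'o, 'm::ab_group_add) tricat \<Rightarrow> (real \<Rightarrow> 'o set) \<Rightarrow> bool" where
  "slicing C P \<longleftrightarrow>
     (\<forall>t E. zero_object C E \<longrightarrow> E \<in> P t) \<and>
     (\<forall>t E E'. E \<in> P t \<and> isomorphic C E E' \<longrightarrow> E' \<in> P t) \<and>
     (\<forall>t A B E \<iota> \<pi>. A \<in> P t \<and> B \<in> P t \<and>
        biproduct C (UNIV :: bool set) (\<lambda>b. if b then A else B) E \<iota> \<pi> \<longrightarrow> E \<in> P t) \<and>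
     (\<forall>t. P (t + 1) = sh C 1 ` P t) \<and>
     (\<forall>s t A B. s > t \<and> A \<in> P s \<and> B \<in> P t \<longrightarrow> Hom C A B = {0}) \<and>
     (\<forall>Y. \<not> zero_object C Y \<longrightarrow> (\<exists>n E A \<psi>. HN_filtration C P Y n E A \<psi>))"

text \<open>The extension-closed subcategory generated by the slices with phase in \<open>I\<close>.\<close>

inductive_set interval_cat :: "('k, 'o, 'm::zero) tricat \<Rightarrow> (real \<Rightarrow> 'o set) \<Rightarrow> real set \<Rightarrow> 'o set"
  for C :: "('k, 'o, 'm::zero) tricat" and P :: "real \<Rightarrow> 'o set" and I :: "real set"
  where
    zero: "zero_object C E \<Longrightarrow> E \<in> interval_cat C P I"
  | slice: "\<lbrakk>t \<in> I; E \<in> P t\<rbrakk> \<Longrightarrow> E \<in> interval_cat C P I"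
  | extension: "\<lbrakk>A \<in> interval_cat C P I; B \<in> interval_cat C P I; dist C A E B f g h\<rbrakk>
      \<Longrightarrow> E \<in> interval_cat C P I"

text \<open>Monomorphisms and kernels in the full subcategory on a set \<open>S\<close> of objects.\<close>

definition mono_in :: "('k, 'o, 'm) tricat \<Rightarrow> 'o set \<Rightarrow> 'o \<Rightarrow> 'o \<Rightarrow> 'm \<Rightarrow> bool" where
  "mono_in C S A E i \<longleftrightarrow> A \<in> S \<and> E \<in> S \<and> i \<in> Hom C A E \<and>
     (\<forall>W\<in>S. \<forall>u \<in> Hom C W A. \<forall>v \<in> Hom C W A. i \<cdot>\<^bsub>C\<^esub> u = i \<cdot>\<^bsub>C\<^esub> v \<longrightarrow> u = v)"

definition kernel_in :: "('k, 'o, 'm::zero) tricat \<Rightarrow> 'o set \<Rightarrow> 'o \<Rightarrow> 'o \<Rightarrow> 'o \<Rightarrow> 'm \<Rightarrow> 'm \<Rightarrow> bool"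
  where
  "kernel_in C S A E D i p \<longleftrightarrow> A \<in> S \<and> E \<in> S \<and> D \<in> S \<and>
     i \<in> Hom C A E \<and> p \<in> Hom C E D \<and> p \<cdot>\<^bsub>C\<^esub> i = 0 \<and>
     (\<forall>W\<in>S. \<forall>w \<in> Hom C W E. p \<cdot>\<^bsub>C\<^esub> w = 0 \<longrightarrow> (\<exists>!u. u \<in> Hom C W A \<and> i \<cdot>\<^bsub>C\<^esub> u = w))"

text \<open>In a quasi-abelian category the strict monomorphisms are the kernels.\<close>

definition strict_mono_in :: "('k, 'o, 'm::zero) tricat \<Rightarrow> 'o set \<Rightarrow> 'o \<Rightarrow> 'o \<Rightarrow> 'm \<Rightarrow> bool" where
  "strict_mono_in C S A E i \<longleftrightarrow> (\<exists>D p. kernel_in C S A E D i p)"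

text \<open>Ascending and descending chains of strict subobjects become stationary.\<close>

definition finite_length :: "('k, 'o, 'm::zero) tricat \<Rightarrow> 'o set \<Rightarrow> bool" where
  "finite_length C S \<longleftrightarrow>
     (\<forall>E A i j. (\<forall>n. strict_mono_in C S (A n) E (i n) \<and>
          j n \<in> Hom C (A n) (A (Suc n)) \<and> i (Suc n) \<cdot>\<^bsub>C\<^esub> j n = i n) \<longrightarrow>
        (\<exists>N::nat. \<forall>n\<ge>N. is_iso C (A n) (A (Suc n)) (j n))) \<and>
     (\<forall>E A i j. (\<forall>n. strict_mono_in C S (A n) E (i n) \<and>
          j n \<in> Hom C (A (Suc n)) (A n) \<and> i n \<cdot>\<^bsub>C\<^esub> j n = i (Suc n)) \<longrightarrow>
        (\<exists>N::nat. \<forall>n\<ge>N. is_iso C (A (Suc n)) (A n) (j n)))"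

text \<open>
  Intervals of length less than 1 are those for which Bridgeland shows that the subcategory is
  quasi-abelian; a smaller positive \<open>r\<close> may always be taken.
\<close>

definition locally_finite :: "('k, 'o, 'm::zero) tricat \<Rightarrow> (real \<Rightarrow> 'o set) \<Rightarrow> bool" where
  "locally_finite C P \<longleftrightarrow>
     (\<exists>r>0. r < 1 / 2 \<and> (\<forall>t. finite_length C (interval_cat C P {t - r<..<t + r})))"

text \<open>
  A homomorphism from the Grothendieck group to the complex numbers is a function on objects that
  is additive on triangles. Local finiteness is part of the notion, as for the points of Bridgeland's
  space of stability conditions; it provides Jordan--Hoelder filtrations of semistable objects by
  stable ones.
\<close>

definition stability_condition ::
    "('k::field, 'o, 'm::ab_group_add) tricat \<Rightarrow> 'o stability \<Rightarrow> bool" where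
  "stability_condition C \<tau> \<longleftrightarrow> slicing C (slice \<tau>) \<and> locally_finite C (slice \<tau>) \<and>
     (\<forall>X Y Z f g h. dist C X Y Z f g h \<longrightarrow> charge \<tau> Y = charge \<tau> X + charge \<tau> Z) \<and>
     (\<forall>t. \<forall>E \<in> slice \<tau> t. \<not> zero_object C E \<longrightarrow>
        (\<exists>m::real. m > 0 \<and> charge \<tau> E = of_real m * exp (\<i> * of_real (pi * t))))"

definition semistable :: "('k, 'o, 'm::zero) tricat \<Rightarrow> 'o stability \<Rightarrow> 'o \<Rightarrow> bool" where
  "semistable C \<tau> X \<longleftrightarrow> \<not> zero_object C X \<and> (\<exists>t. X \<in> slice \<tau> t)"

definition phase :: "'o stability \<Rightarrow> 'o \<Rightarrow> real" where
  "phase \<tau> X = (THE t. X \<in> slice \<tau> t)"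

text \<open>The stable objects of phase \<open>t\<close> are the simple objects of the abelian category \<open>slice \<tau> t\<close>.\<close>

definition stable_object :: "('k, 'o, 'm::zero) tricat \<Rightarrow> 'o stability \<Rightarrow> 'o \<Rightarrow> bool" where
  "stable_object C \<tau> X \<longleftrightarrow> semistable C \<tau> X \<and>
     (\<forall>A i. mono_in C (slice \<tau> (phase \<tau> X)) A X i \<longrightarrow> zero_object C A \<or> is_iso C A X i)"

definition phase_max :: "('k, 'o, 'm::zero) tricat \<Rightarrow> 'o stability \<Rightarrow> 'o \<Rightarrow> real" where
  "phase_max C \<tau> Y = (THE t. \<exists>n E A \<psi>. HN_filtration C (slice \<tau>) Y n E A \<psi> \<and> t = \<psi> 0)"

definition phase_min :: "('k, 'o, 'm::zero) tricat \<Rightarrow> 'o stability \<Rightarrow> 'o \<Rightarrow> real" where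
  "phase_min C \<tau> Y = (THE t. \<exists>n E A \<psi>. HN_filtration C (slice \<tau>) Y n E A \<psi> \<and> t = \<psi> (n - 1))"

end

theory Submission
  imports Defs
begin

text \<open>
  By the triangles defining the twists and the Calabi--Yau property, part (1) amounts to
  $\mathrm{Hom}^m(X,Y)=0$ for all \<open>m < 0\<close> with $\phi^+(Y)+m<\phi^-(Y)+1$; the hypothesis
  $\phi^+(Y)-\phi^-(Y)\ge 1$ makes the relevant degrees negative. The last Harder--Narasimhan
  factor of \<open>Y\<close> has \<open>X\<close> as its stable quotient, so a morphism $a : X \to Y[m]$ yields
  $Y \to X \to Y[m]$, which is zero because $\mathrm{Hom}^m(Y,Y)=0$. Hence \<open>a\<close> factors through the
  shifted fibre of $Y \to X$, whose phases are at least $\phi^-(Y)+1$, above those of $Y[m]$; so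
  $a=0$. Part (2) is dual and uses a stable subobject of the first factor.
\<close>

text \<open>The degrees match as follows. A basis element of Hom^i(Y,X) puts a summand X[i] into the
  coevaluation object and is dual to Hom^m(X,Y) with m = 2 - i. A map into the inverse twist that
  dies in Y comes from a map of the once shifted source into that object, so summands of phase at
  most phi^+(Y) + 1 are harmless; a larger phase means m < phi(X) - phi^+(Y) + 1. The main obstacle
  is the existence of stable quotients and subobjects. Stability is stated through monomorphisms in
  a slice, local finiteness through strict subobjects in an interval subcategory, and no kernels or
  cokernels in a slice are given in advance. The bridge is that the cone of a monomorphism in a
  slice stays in the slice, which is proved with the central charge. From then on subobjects and
  quotients are triangles with all vertices in the slice, and preimages of subobjects come from the
  octahedral axiom.\<close>

section \<open>Linear and triangulated categories\<close>

context klinear_category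
begin

sublocale vs: vector_space "scal C"
  by (rule vector_space_scal)

lemma zero_Hom: "0 \<in> Hom C X Y"
  using vs.subspace_0[OF subspace_Hom] .

lemma add_Hom: "f \<in> Hom C X Y \<Longrightarrow> g \<in> Hom C X Y \<Longrightarrow> f + g \<in> Hom C X Y"
  using vs.subspace_add[OF subspace_Hom] .

lemma uminus_Hom: "f \<in> Hom C X Y \<Longrightarrow> - f \<in> Hom C X Y"
  using vs.subspace_neg[OF subspace_Hom] .

lemma diff_Hom: "f \<in> Hom C X Y \<Longrightarrow> g \<in> Hom C X Y \<Longrightarrow> f - g \<in> Hom C X Y"
  using vs.subspace_diff[OF subspace_Hom] .

lemma cmp_zero_left: "f \<in> Hom C X Y \<Longrightarrow> 0 \<cdot>\<^bsub>C\<^esub> f = 0"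
  using cmp_add_left[of f X Y 0 Y 0] by (simp add: zero_Hom)

lemma cmp_zero_right: "g \<in> Hom C Y Z \<Longrightarrow> g \<cdot>\<^bsub>C\<^esub> 0 = 0"
  using cmp_add_right[of 0 Y Y 0 g Z] by (simp add: zero_Hom)

lemma cmp_uminus_left: "f \<in> Hom C X Y \<Longrightarrow> g \<in> Hom C Y Z \<Longrightarrow> (- g) \<cdot>\<^bsub>C\<^esub> f = - (g \<cdot>\<^bsub>C\<^esub> f)"
  using cmp_add_left[of f X Y g Z "- g"]
  by (simp add: uminus_Hom cmp_zero_left eq_neg_iff_add_eq_0 add.commute)

lemma cmp_uminus_right: "f \<in> Hom C X Y \<Longrightarrow> g \<in> Hom C Y Z \<Longrightarrow> g \<cdot>\<^bsub>C\<^esub> (- f) = - (g \<cdot>\<^bsub>C\<^esub> f)"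
  using cmp_add_right[of f X Y "- f" g Z]
  by (simp add: uminus_Hom cmp_zero_right eq_neg_iff_add_eq_0 add.commute)

lemma cmp_diff_right:
  "f \<in> Hom C X Y \<Longrightarrow> f' \<in> Hom C X Y \<Longrightarrow> g \<in> Hom C Y Z \<Longrightarrow> g \<cdot>\<^bsub>C\<^esub> (f - f') = g \<cdot>\<^bsub>C\<^esub> f - g \<cdot>\<^bsub>C\<^esub> f'"
  using cmp_add_right[of f X Y "- f'" g Z] by (simp add: uminus_Hom cmp_uminus_right)

lemma zero_object_iff_idt: "zero_object C X \<longleftrightarrow> idt C X = 0"
proof
  assume "idt C X = 0"
  then have "f = 0" if "f \<in> Hom C X W \<or> f \<in> Hom C W X" for f W
    using that cmp_idt_left[of f W X] cmp_idt_right[of f X W]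
      cmp_zero_left[of f W X] cmp_zero_right[of f X W] by auto
  then show "zero_object C X"
    unfolding zero_object_def using zero_Hom by blast
qed (use idt_Hom in \<open>auto simp: zero_object_def\<close>)

lemma is_iso_inverse:
  assumes "is_iso C X Y f"
  obtains g where "is_iso C Y X g" "g \<cdot>\<^bsub>C\<^esub> f = idt C X" "f \<cdot>\<^bsub>C\<^esub> g = idt C Y"
  using assms unfolding is_iso_def by blast

lemma isomorphic_sym: "isomorphic C X Y \<Longrightarrow> isomorphic C Y X"
  unfolding isomorphic_def by (metis is_iso_inverse)

lemma Hom_eq_zero_iso_source:
  assumes "isomorphic C X X'" "Hom C X Y = {0}"
  shows "Hom C X' Y = {0}"
proof -
  obtain f g where fg: "f \<in> Hom C X X'" "g \<in> Hom C X' X" "f \<cdot>\<^bsub>C\<^esub> g = idt C X'"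
    using assms(1) unfolding isomorphic_def is_iso_def by blast
  have "a = 0" if a: "a \<in> Hom C X' Y" for a
  proof -
    have "a \<cdot>\<^bsub>C\<^esub> f = 0" using assms(2) cmp_Hom[OF fg(1) a] by auto
    then have "a \<cdot>\<^bsub>C\<^esub> (f \<cdot>\<^bsub>C\<^esub> g) = 0" using cmp_assoc[OF fg(2,1) a] cmp_zero_left[OF fg(2)] by simp
    then show ?thesis using fg(3) cmp_idt_right[OF a] by simp
  qed
  then show ?thesis using zero_Hom by blast
qed

lemma Hom_eq_zero_iso_target:
  assumes "isomorphic C Y Y'" "Hom C X Y = {0}"
  shows "Hom C X Y' = {0}"
proof -
  obtain f g where fg: "f \<in> Hom C Y Y'" "g \<in> Hom C Y' Y" "f \<cdot>\<^bsub>C\<^esub> g = idt C Y'"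
    using assms(1) unfolding isomorphic_def is_iso_def by blast
  have "a = 0" if a: "a \<in> Hom C X Y'" for a
  proof -
    have "g \<cdot>\<^bsub>C\<^esub> a = 0" using assms(2) cmp_Hom[OF a fg(2)] by auto
    then have "(f \<cdot>\<^bsub>C\<^esub> g) \<cdot>\<^bsub>C\<^esub> a = 0" using cmp_assoc[OF a fg(2,1)] cmp_zero_right[OF fg(1)] by simp
    then show ?thesis using fg(3) cmp_idt_left[OF a] by simp
  qed
  then show ?thesis using zero_Hom by blast
qed

lemma zero_object_iso: "isomorphic C X Y \<Longrightarrow> zero_object C X \<Longrightarrow> zero_object C Y"
  unfolding zero_object_def using Hom_eq_zero_iso_source Hom_eq_zero_iso_target by metis

lemma cmp_sum_left:
  assumes "finite I" "\<And>i. i \<in> I \<Longrightarrow> g i \<in> Hom C Y Z" "f \<in> Hom C X Y"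
  shows "(\<Sum>i\<in>I. g i) \<in> Hom C Y Z \<and> (\<Sum>i\<in>I. g i) \<cdot>\<^bsub>C\<^esub> f = (\<Sum>i\<in>I. g i \<cdot>\<^bsub>C\<^esub> f)"
  using assms(1,2)
proof (induction I)
  case (insert x F)
  then show ?case using cmp_add_left[OF assms(3), of "g x" Z "sum g F"] by (simp add: add_Hom)
qed (simp add: zero_Hom cmp_zero_left[OF assms(3)])

lemma cmp_sum_right:
  assumes "finite I" "\<And>i. i \<in> I \<Longrightarrow> f i \<in> Hom C X Y" "g \<in> Hom C Y Z"
  shows "(\<Sum>i\<in>I. f i) \<in> Hom C X Y \<and> g \<cdot>\<^bsub>C\<^esub> (\<Sum>i\<in>I. f i) = (\<Sum>i\<in>I. g \<cdot>\<^bsub>C\<^esub> f i)"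
  using assms(1,2)
proof (induction I)
  case (insert x F)
  then show ?case using cmp_add_right[OF _ _ assms(3), of "f x" X "sum f F"] by (simp add: add_Hom)
qed (simp add: zero_Hom cmp_zero_right[OF assms(3)])

lemma Hom_biproduct_target:
  assumes bp: "biproduct C I F E \<iota> \<pi>" and z: "\<And>i. i \<in> I \<Longrightarrow> Hom C A (F i) = {0}"
  shows "Hom C A E = {0}"
proof -
  have fin: "finite I" and \<iota>: "\<And>i. i \<in> I \<Longrightarrow> \<iota> i \<in> Hom C (F i) E"
    and \<pi>: "\<And>i. i \<in> I \<Longrightarrow> \<pi> i \<in> Hom C E (F i)" and s: "(\<Sum>i\<in>I. \<iota> i \<cdot>\<^bsub>C\<^esub> \<pi> i) = idt C E"
    using bp unfolding biproduct_def by auto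
  have "a = 0" if a: "a \<in> Hom C A E" for a
  proof -
    have "(\<iota> i \<cdot>\<^bsub>C\<^esub> \<pi> i) \<cdot>\<^bsub>C\<^esub> a = 0" if i: "i \<in> I" for i
      using cmp_assoc[OF a \<pi>[OF i] \<iota>[OF i]] cmp_Hom[OF a \<pi>[OF i]] z[OF i] cmp_zero_right[OF \<iota>[OF i]]
      by auto
    moreover have "a = (\<Sum>i\<in>I. (\<iota> i \<cdot>\<^bsub>C\<^esub> \<pi> i) \<cdot>\<^bsub>C\<^esub> a)"
      using cmp_sum_left[of I "\<lambda>i. \<iota> i \<cdot>\<^bsub>C\<^esub> \<pi> i", OF fin cmp_Hom[OF \<pi> \<iota>] a] s cmp_idt_left[OF a]
      by simp
    ultimately show "a = 0" by simp
  qed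
  then show ?thesis using zero_Hom by blast
qed

lemma Hom_biproduct_source:
  assumes bp: "biproduct C I F E \<iota> \<pi>" and z: "\<And>i. i \<in> I \<Longrightarrow> Hom C (F i) B = {0}"
  shows "Hom C E B = {0}"
proof -
  have fin: "finite I" and \<iota>: "\<And>i. i \<in> I \<Longrightarrow> \<iota> i \<in> Hom C (F i) E"
    and \<pi>: "\<And>i. i \<in> I \<Longrightarrow> \<pi> i \<in> Hom C E (F i)" and s: "(\<Sum>i\<in>I. \<iota> i \<cdot>\<^bsub>C\<^esub> \<pi> i) = idt C E"
    using bp unfolding biproduct_def by auto
  have "a = 0" if a: "a \<in> Hom C E B" for a
  proof -
    have "a \<cdot>\<^bsub>C\<^esub> (\<iota> i \<cdot>\<^bsub>C\<^esub> \<pi> i) = 0" if i: "i \<in> I" for i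
      using cmp_assoc[OF \<pi>[OF i] \<iota>[OF i] a] cmp_Hom[OF \<iota>[OF i] a] z[OF i] cmp_zero_left[OF \<pi>[OF i]]
      by auto
    moreover have "a = (\<Sum>i\<in>I. a \<cdot>\<^bsub>C\<^esub> (\<iota> i \<cdot>\<^bsub>C\<^esub> \<pi> i))"
      using cmp_sum_right[of I "\<lambda>i. \<iota> i \<cdot>\<^bsub>C\<^esub> \<pi> i", OF fin cmp_Hom[OF \<pi> \<iota>] a] s cmp_idt_right[OF a]
      by simp
    ultimately show "a = 0" by simp
  qed
  then show ?thesis using zero_Hom by blast
qed

end

section \<open>Exactness of Hom along distinguished triangles\<close>

context triangulated_category
begin

lemma shm_0: "shm C n 0 = 0"
  using shm_add[of 0 undefined undefined 0 n] by (simp add: zero_Hom)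

lemma shm_uminus: "f \<in> Hom C X Y \<Longrightarrow> shm C n (- f) = - shm C n f"
  using shm_add[of f X Y "- f" n] by (simp add: uminus_Hom shm_0 eq_neg_iff_add_eq_0 add.commute)

lemma sh_neg_sh: "sh C (- n) (sh C n X) = X" "sh C n (sh C (- n) X) = X"
  using sh_add[of "- n" n X] sh_add[of n "- n" X] by (simp_all add: sh_zero)

lemma shm_neg_shm:
  assumes "f \<in> Hom C X Y"
  shows "shm C (- n) (shm C n f) = f" "shm C n (shm C (- n) f) = f"
  using assms shm_plus[OF assms, of "- n" n] shm_plus[OF assms, of n "- n"] by (simp_all add: shm_zero)

lemma Hom_sh_eq_zero_iff: "Hom C (sh C n X) (sh C n Y) = {0} \<longleftrightarrow> Hom C X Y = {0}"
proof -
  have "Hom C A B = {0}" if "Hom C (sh C n A) (sh C n B) = {0}" for A B n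
  proof -
    have "f = 0" if "f \<in> Hom C A B" for f
      using shm_Hom[OF that, of n] shm_neg_shm(1)[OF that, of n] shm_0
        \<open>Hom C (sh C n A) (sh C n B) = {0}\<close> by auto
    then show ?thesis using zero_Hom by blast
  qed
  from this[of n X Y] this[of "- n" "sh C n X" "sh C n Y"] show ?thesis
    by (auto simp: sh_neg_sh)
qed

lemma zero_object_sh: "zero_object C X \<Longrightarrow> zero_object C (sh C n X)"
  using shm_idt[of n X] by (simp add: zero_object_iff_idt shm_0)

lemma is_iso_shm: "is_iso C X Y f \<Longrightarrow> is_iso C (sh C n X) (sh C n Y) (shm C n f)"
  unfolding is_iso_def using shm_Hom shm_cmp shm_idt by metis

lemma dist_rotated: "dist C X Y Z f g h \<Longrightarrow> dist C Y Z (sh C 1 X) g h (- shm C 1 f)"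
  using dist_rotate dist_Hom by metis

lemma dist_cmp_zero:
  assumes T: "dist C X Y Z f g h"
  shows "g \<cdot>\<^bsub>C\<^esub> f = 0"
proof -
  obtain O' where O': "zero_object C O'" using ex_zero_object by blast
  have H: "f \<in> Hom C X Y" "g \<in> Hom C Y Z" using dist_Hom[OF T] by auto
  obtain w where "w \<in> Hom C O' Z" "w \<cdot>\<^bsub>C\<^esub> 0 = g \<cdot>\<^bsub>C\<^esub> f"
    using dist_morphism[OF dist_idt[OF O', of X] T idt_Hom H(1)] by auto
  then show ?thesis using cmp_zero_right by metis
qed

text \<open>TR3, applied to the rotated identity triangle W -> 0 -> W[1] and to the rotation of
  \<open>T\<close>, yields the factorisation after one shift; shifting by -1 undoes this.\<close>

lemma dist_lift:
  assumes T: "dist C X Y Z f g h" and a: "a \<in> Hom C W Y" and z: "g \<cdot>\<^bsub>C\<^esub> a = 0"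
  obtains b where "b \<in> Hom C W X" "a = f \<cdot>\<^bsub>C\<^esub> b"
proof -
  obtain O' where O': "zero_object C O'" using ex_zero_object by blast
  have H: "f \<in> Hom C X Y" "g \<in> Hom C Y Z" using dist_Hom[OF T] by auto
  have T1: "dist C W O' (sh C 1 W) 0 0 (- shm C 1 (idt C W))"
    by (rule dist_rotated[OF dist_idt[OF O']])
  have "0 \<cdot>\<^bsub>C\<^esub> 0 = g \<cdot>\<^bsub>C\<^esub> a" using z cmp_zero_left[OF zero_Hom] by simp
  then obtain w where w: "w \<in> Hom C (sh C 1 W) (sh C 1 X)"
    "shm C 1 a \<cdot>\<^bsub>C\<^esub> (- shm C 1 (idt C W)) = (- shm C 1 f) \<cdot>\<^bsub>C\<^esub> w"
    using dist_morphism[OF T1 dist_rotated[OF T] a zero_Hom] by auto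
  have a1: "shm C 1 a \<in> Hom C (sh C 1 W) (sh C 1 Y)" and f1: "shm C 1 f \<in> Hom C (sh C 1 X) (sh C 1 Y)"
    using shm_Hom a H by auto
  have "shm C 1 a = shm C 1 f \<cdot>\<^bsub>C\<^esub> w"
    using w(2) cmp_uminus_right[OF idt_Hom a1] cmp_uminus_left[OF w(1) f1] cmp_idt_right[OF a1]
    by (simp add: shm_idt)
  then have "shm C (-1) (shm C 1 a) = shm C (-1) (shm C 1 f) \<cdot>\<^bsub>C\<^esub> shm C (-1) w"
    using shm_cmp[OF w(1) f1] by simp
  then have "a = f \<cdot>\<^bsub>C\<^esub> shm C (-1) w"
    using shm_neg_shm(1)[OF a, of 1] shm_neg_shm(1)[OF H(1), of 1] by simp
  moreover have "shm C (-1) w \<in> Hom C W X"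
    using shm_Hom[OF w(1), of "-1"] sh_neg_sh(1)[of 1] by simp
  ultimately show ?thesis using that by blast
qed

text \<open>Here TR3 maps \<open>T\<close> to the triangle 0 -> W -> W, which is an identity
  triangle rotated backwards.\<close>

lemma dist_extend:
  assumes T: "dist C X Y Z f g h" and a: "a \<in> Hom C Y W" and z: "a \<cdot>\<^bsub>C\<^esub> f = 0"
  obtains b where "b \<in> Hom C Z W" "a = b \<cdot>\<^bsub>C\<^esub> g"
proof -
  obtain O' where O': "zero_object C O'" using ex_zero_object by blast
  have "dist C W W (sh C 1 O') (idt C W) 0 (- shm C 1 0)"
    using dist_idt[OF zero_object_sh[OF O']] by (simp add: shm_0)
  then have T1: "dist C O' W W 0 (idt C W) 0"
    using dist_rotate[OF zero_Hom idt_Hom zero_Hom] by blast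
  have "a \<cdot>\<^bsub>C\<^esub> f = 0 \<cdot>\<^bsub>C\<^esub> 0" using z cmp_zero_left[OF zero_Hom] by simp
  then obtain w where "w \<in> Hom C Z W" "w \<cdot>\<^bsub>C\<^esub> g = idt C W \<cdot>\<^bsub>C\<^esub> a"
    using dist_morphism[OF T T1 zero_Hom a] by auto
  then show ?thesis using that cmp_idt_left[OF a] by auto
qed

lemma dist_Hom_middle_target:
  assumes "dist C X Y Z f g h" "Hom C W X = {0}" "Hom C W Z = {0}"
  shows "Hom C W Y = {0}"
proof -
  have H: "f \<in> Hom C X Y" "g \<in> Hom C Y Z" using dist_Hom[OF assms(1)] by auto
  have "a = 0" if a: "a \<in> Hom C W Y" for a
  proof -
    have "g \<cdot>\<^bsub>C\<^esub> a = 0" using assms(3) cmp_Hom[OF a H(2)] by auto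
    then obtain b where "b \<in> Hom C W X" "a = f \<cdot>\<^bsub>C\<^esub> b" using dist_lift[OF assms(1) a] by blast
    then show ?thesis using assms(2) cmp_zero_right[OF H(1)] by auto
  qed
  then show ?thesis using zero_Hom by blast
qed

lemma dist_Hom_middle_source:
  assumes "dist C X Y Z f g h" "Hom C X W = {0}" "Hom C Z W = {0}"
  shows "Hom C Y W = {0}"
proof -
  have H: "f \<in> Hom C X Y" "g \<in> Hom C Y Z" using dist_Hom[OF assms(1)] by auto
  have "a = 0" if a: "a \<in> Hom C Y W" for a
  proof -
    have "a \<cdot>\<^bsub>C\<^esub> f = 0" using assms(2) cmp_Hom[OF H(1) a] by auto
    then obtain b where "b \<in> Hom C Z W" "a = b \<cdot>\<^bsub>C\<^esub> g" using dist_extend[OF assms(1) a] by blast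
    then show ?thesis using assms(3) cmp_zero_left[OF H(2)] by auto
  qed
  then show ?thesis using zero_Hom by blast
qed

text \<open>The kernel of composition with \<open>f\<close> is the image of Hom(W, Z[-1]). The shift
  is moved to \<open>W\<close>, so that vanishing can be read off from phases of
  \<open>sh C 1 W\<close>.\<close>

lemma dist_cancel_left:
  assumes T: "dist C X Y Z f g h" and a: "a \<in> Hom C W X" and z: "f \<cdot>\<^bsub>C\<^esub> a = 0"
    and v: "Hom C (sh C 1 W) Z = {0}"
  shows "a = 0"
proof -
  have H: "f \<in> Hom C X Y" "h \<in> Hom C Z (sh C 1 X)" using dist_Hom[OF T] by auto
  have a1: "shm C 1 a \<in> Hom C (sh C 1 W) (sh C 1 X)" using shm_Hom[OF a] .
  have "(- shm C 1 f) \<cdot>\<^bsub>C\<^esub> shm C 1 a = 0"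
    using cmp_uminus_left[OF a1 shm_Hom[OF H(1)]] shm_cmp[OF a H(1), of 1] z by (simp add: shm_0)
  then obtain b where "b \<in> Hom C (sh C 1 W) Z" "shm C 1 a = h \<cdot>\<^bsub>C\<^esub> b"
    using dist_lift[OF dist_rotated[OF dist_rotated[OF T]] a1] by blast
  then have "shm C 1 a = 0" using v cmp_zero_right[OF H(2)] by auto
  then show ?thesis using shm_neg_shm(1)[OF a, of 1] by (simp add: shm_0)
qed

text \<open>By exactness at \<open>Z\<close>, the kernel of precomposition with \<open>g\<close> is
  the image of Hom(X[1], W).\<close>

lemma dist_cancel_right:
  assumes T: "dist C X Y Z f g h" and a: "a \<in> Hom C Z W" and z: "a \<cdot>\<^bsub>C\<^esub> g = 0"
    and v: "Hom C (sh C 1 X) W = {0}"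
  shows "a = 0"
proof -
  have H: "h \<in> Hom C Z (sh C 1 X)" using dist_Hom[OF T] by auto
  obtain b where "b \<in> Hom C (sh C 1 X) W" "a = b \<cdot>\<^bsub>C\<^esub> h"
    using dist_extend[OF dist_rotated[OF T] a z] by blast
  then show ?thesis using v cmp_zero_left[OF H] by auto
qed

lemma dist_iso_iff_cone_zero:
  assumes T: "dist C X Y Z f g h"
  shows "is_iso C X Y f \<longleftrightarrow> zero_object C Z"
proof
  have H: "f \<in> Hom C X Y" "g \<in> Hom C Y Z" "h \<in> Hom C Z (sh C 1 X)" using dist_Hom[OF T] by auto
  {
    assume "is_iso C X Y f"
    then obtain f' where f': "f' \<in> Hom C Y X" "f' \<cdot>\<^bsub>C\<^esub> f = idt C X" "f \<cdot>\<^bsub>C\<^esub> f' = idt C Y"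
      unfolding is_iso_def by blast
    have "g = (g \<cdot>\<^bsub>C\<^esub> f) \<cdot>\<^bsub>C\<^esub> f'"
      using cmp_assoc[OF f'(1) H(1,2)] f'(3) cmp_idt_right[OF H(2)] by simp
    then have g0: "g = 0" using dist_cmp_zero[OF T] cmp_zero_left[OF f'(1)] by simp
    have f1: "shm C 1 f \<in> Hom C (sh C 1 X) (sh C 1 Y)"
      and f'1: "shm C 1 f' \<in> Hom C (sh C 1 Y) (sh C 1 X)" using shm_Hom H f' by auto
    have "(- shm C 1 f) \<cdot>\<^bsub>C\<^esub> h = 0" using dist_cmp_zero[OF dist_rotated[OF dist_rotated[OF T]]] .
    then have "shm C 1 f \<cdot>\<^bsub>C\<^esub> h = 0" using cmp_uminus_left[OF H(3) f1] by simp
    then have "(shm C 1 f' \<cdot>\<^bsub>C\<^esub> shm C 1 f) \<cdot>\<^bsub>C\<^esub> h = 0"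
      using cmp_assoc[OF H(3) f1 f'1] cmp_zero_right[OF f'1] by simp
    then have h0: "h = 0"
      using shm_cmp[OF H(1) f'(1), of 1] f'(2) shm_idt cmp_idt_left[OF H(3)] by simp
    have "h \<cdot>\<^bsub>C\<^esub> idt C Z = 0" using h0 cmp_zero_left[OF idt_Hom] by simp
    then obtain b where "b \<in> Hom C Z Y" "idt C Z = g \<cdot>\<^bsub>C\<^esub> b"
      using dist_lift[OF dist_rotated[OF T] idt_Hom] by blast
    then show "zero_object C Z"
      using g0 cmp_zero_left zero_object_iff_idt by metis
  next
    assume Z: "zero_object C Z"
    then have "g \<cdot>\<^bsub>C\<^esub> idt C Y = 0" using H cmp_Hom[OF idt_Hom H(2)] unfolding zero_object_def by blast
    then obtain b where b: "b \<in> Hom C Y X" "idt C Y = f \<cdot>\<^bsub>C\<^esub> b"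
      using dist_lift[OF T idt_Hom] by blast
    have bf: "b \<cdot>\<^bsub>C\<^esub> f \<in> Hom C X X" using cmp_Hom[OF H(1) b(1)] .
    have "f \<cdot>\<^bsub>C\<^esub> (b \<cdot>\<^bsub>C\<^esub> f) = f"
      using cmp_assoc[OF H(1) b(1) H(1)] b(2) cmp_idt_left[OF H(1)] by simp
    then have "f \<cdot>\<^bsub>C\<^esub> (b \<cdot>\<^bsub>C\<^esub> f - idt C X) = 0"
      using cmp_diff_right[OF bf idt_Hom H(1)] cmp_idt_right[OF H(1)] by simp
    moreover have "Hom C (sh C 1 X) Z = {0}" using Z unfolding zero_object_def by blast
    ultimately have "b \<cdot>\<^bsub>C\<^esub> f - idt C X = 0"
      using dist_cancel_left[OF T diff_Hom[OF bf idt_Hom]] by blast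
    then show "is_iso C X Y f"
      unfolding is_iso_def using H(1) b by auto
  }
qed

lemma dist_zero_source_iso:
  assumes T: "dist C X Y Z f g h" and X: "zero_object C X"
  shows "is_iso C Y Z g"
  using dist_iso_iff_cone_zero[OF dist_rotated[OF T]] zero_object_sh[OF X] by blast

end

section \<open>Phases\<close>

text \<open>This is phi^+(Z) <= t expressed by test objects. In this form the bound covers zero
  objects as well and passes through triangles by exactness alone; \<open>phases_ge\<close> is the
  dual bound on phi^-.\<close>

definition phases_le :: "('k, 'o, 'm::zero) tricat \<Rightarrow> (real \<Rightarrow> 'o set) \<Rightarrow> 'o \<Rightarrow> real \<Rightarrow> bool" where
  "phases_le C P Z t \<longleftrightarrow> (\<forall>s>t. \<forall>A \<in> P s. Hom C A Z = {0})"

definition phases_ge :: "('k, 'o, 'm::zero) tricat \<Rightarrow> (real \<Rightarrow> 'o set) \<Rightarrow> 'o \<Rightarrow> real \<Rightarrow> bool" where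
  "phases_ge C P Z t \<longleftrightarrow> (\<forall>s<t. \<forall>B \<in> P s. Hom C Z B = {0})"

locale triangulated_stability = triangulated_category C
  for C :: "('k::field, 'o, 'm::ab_group_add) tricat" +
  fixes \<tau> :: "'o stability"
  assumes stab: "stability_condition C \<tau>"
begin

abbreviation P :: "real \<Rightarrow> 'o set" where "P \<equiv> slice \<tau>"

lemma slicing: "slicing C P"
  and charge_dist: "dist C A E B f g h \<Longrightarrow> charge \<tau> E = charge \<tau> A + charge \<tau> B"
  and charge_slice: "E \<in> P t \<Longrightarrow> \<not> zero_object C E \<Longrightarrow>
    \<exists>m::real. m > 0 \<and> charge \<tau> E = of_real m * exp (\<i> * of_real (pi * t))"
  and locally_finite: "locally_finite C P"
  using stab unfolding stability_condition_def by meson+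

lemma zero_slice: "zero_object C E \<Longrightarrow> E \<in> P t"
  and iso_slice: "E \<in> P t \<Longrightarrow> isomorphic C E E' \<Longrightarrow> E' \<in> P t"
  and slice_shift_one: "P (t + 1) = sh C 1 ` P t"
  and Hom_slice_zero: "t < s \<Longrightarrow> A \<in> P s \<Longrightarrow> B \<in> P t \<Longrightarrow> Hom C A B = {0}"
  and ex_HN: "\<not> zero_object C Y \<Longrightarrow> \<exists>n E A \<psi>. HN_filtration C P Y n E A \<psi>"
  using slicing unfolding slicing_def by meson+

lemma phases_leD: "phases_le C P Z t \<Longrightarrow> A \<in> P s \<Longrightarrow> t < s \<Longrightarrow> Hom C A Z = {0}"
  unfolding phases_le_def by blast

lemma phases_geD: "phases_ge C P Z t \<Longrightarrow> B \<in> P s \<Longrightarrow> s < t \<Longrightarrow> Hom C Z B = {0}"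
  unfolding phases_ge_def by blast

lemma sh_slice_iff: "sh C n E \<in> P (t + of_int n) \<longleftrightarrow> E \<in> P t"
proof -
  have 1: "sh C 1 E \<in> P (t + 1) \<longleftrightarrow> E \<in> P t" for E t
  proof
    assume "sh C 1 E \<in> P (t + 1)"
    then obtain E' where "sh C 1 E = sh C 1 E'" "E' \<in> P t" using slice_shift_one by auto
    then show "E \<in> P t" using sh_neg_sh(1)[of 1] by metis
  qed (simp add: slice_shift_one)
  show ?thesis
  proof (induction n rule: int_induct[where k = 0])
    case base
    then show ?case by (simp add: sh_zero)
  next
    case (step1 i)
    then show ?case
      using 1[of "sh C i E" "t + of_int i"] sh_add[of 1 i E] by (simp add: ac_simps)
  next
    case (step2 i)
    then show ?case
      using 1[of "sh C (i - 1) E" "t + of_int (i - 1)"] sh_add[of 1 "i - 1" E] by simp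
  qed
qed

lemma sh_slice: "E \<in> P t \<Longrightarrow> sh C n E \<in> P (t + of_int n)"
  by (simp add: sh_slice_iff)

lemma slice_phases:
  assumes "Z \<in> P t"
  shows "phases_le C P Z t" "phases_ge C P Z t"
  using assms Hom_slice_zero unfolding phases_le_def phases_ge_def by blast+

lemma phases_le_sh:
  assumes "phases_le C P Z t"
  shows "phases_le C P (sh C n Z) (t + of_int n)"
  unfolding phases_le_def
proof (intro allI impI ballI)
  fix s A assume s: "t + of_int n < s" and A: "A \<in> P s"
  have "sh C (- n) A \<in> P (s - of_int n)" using sh_slice[OF A, of "- n"] by simp
  then have "Hom C (sh C (- n) A) (sh C (- n) (sh C n Z)) = {0}"
    using phases_leD[OF assms] s by (simp add: sh_neg_sh)
  then show "Hom C A (sh C n Z) = {0}" by (simp only: Hom_sh_eq_zero_iff)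
qed

lemma phases_ge_sh:
  assumes "phases_ge C P Z t"
  shows "phases_ge C P (sh C n Z) (t + of_int n)"
  unfolding phases_ge_def
proof (intro allI impI ballI)
  fix s A assume s: "s < t + of_int n" and A: "A \<in> P s"
  have "sh C (- n) A \<in> P (s - of_int n)" using sh_slice[OF A, of "- n"] by simp
  then have "Hom C (sh C (- n) (sh C n Z)) (sh C (- n) A) = {0}"
    using phases_geD[OF assms] s by (simp add: sh_neg_sh)
  then show "Hom C (sh C n Z) A = {0}" by (simp only: Hom_sh_eq_zero_iff)
qed

lemma phases_le_extension:
  "dist C A E B f g h \<Longrightarrow> phases_le C P A t \<Longrightarrow> phases_le C P B t \<Longrightarrow> phases_le C P E t"
  unfolding phases_le_def by (intro allI impI ballI, rule dist_Hom_middle_target) auto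

lemma phases_ge_extension:
  "dist C A E B f g h \<Longrightarrow> phases_ge C P A t \<Longrightarrow> phases_ge C P B t \<Longrightarrow> phases_ge C P E t"
  unfolding phases_ge_def by (intro allI impI ballI, rule dist_Hom_middle_source) auto

lemma phases_le_mono: "phases_le C P Z s \<Longrightarrow> s \<le> t \<Longrightarrow> phases_le C P Z t"
  unfolding phases_le_def by (meson le_less_trans)

lemma phases_ge_mono: "phases_ge C P Z s \<Longrightarrow> t \<le> s \<Longrightarrow> phases_ge C P Z t"
  unfolding phases_ge_def by (meson less_le_trans)

section \<open>Harder-Narasimhan filtrations and the extreme phases\<close>

lemma HN_D:
  assumes "HN_filtration C P Y n E A \<psi>"
  shows "n > 0" "zero_object C (E 0)" "E n = Y"
    and "\<And>j. j < n \<Longrightarrow> \<exists>f g h. dist C (E j) (E (Suc j)) (A j) f g h"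
    and "\<And>j. j < n \<Longrightarrow> A j \<in> P (\<psi> j)" "\<And>j. j < n \<Longrightarrow> \<not> zero_object C (A j)"
    and "\<And>i j. i < j \<Longrightarrow> j < n \<Longrightarrow> \<psi> j < \<psi> i"
  using assms unfolding HN_filtration_def by meson+

lemma HN_phase_mono:
  assumes "HN_filtration C P Y n E A \<psi>" "i \<le> j" "j < n"
  shows "\<psi> j \<le> \<psi> i"
  using HN_D(7)[OF assms(1), of i j] assms(2,3) by (cases "i = j") auto

lemma HN_phases_le_step:
  assumes HN: "HN_filtration C P Y n E A \<psi>" and "j \<le> n"
  shows "phases_le C P (E j) (\<psi> 0)"
  using assms(2)
proof (induction j)
  case 0
  then show ?case using HN_D(2)[OF HN] unfolding phases_le_def zero_object_def by blast
next
  case (Suc j)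
  obtain f g h where T: "dist C (E j) (E (Suc j)) (A j) f g h" using HN_D(4)[OF HN, of j] Suc by auto
  have "phases_le C P (A j) (\<psi> 0)"
    using phases_le_mono[OF slice_phases(1)[OF HN_D(5)[OF HN]]] HN_phase_mono[OF HN] Suc by simp
  then show ?case using phases_le_extension[OF T] Suc by simp
qed

lemma HN_phases_ge_step:
  assumes HN: "HN_filtration C P Y n E A \<psi>" and "j \<le> n"
  shows "phases_ge C P (E j) (\<psi> (n - 1))"
  using assms(2)
proof (induction j)
  case 0
  then show ?case using HN_D(2)[OF HN] unfolding phases_ge_def zero_object_def by blast
next
  case (Suc j)
  obtain f g h where T: "dist C (E j) (E (Suc j)) (A j) f g h" using HN_D(4)[OF HN, of j] Suc by auto
  have "phases_ge C P (A j) (\<psi> (n - 1))"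
    using phases_ge_mono[OF slice_phases(2)[OF HN_D(5)[OF HN]]] HN_phase_mono[OF HN] Suc by simp
  then show ?case using phases_ge_extension[OF T] Suc by simp
qed

lemma HN_phases_le: "HN_filtration C P Y n E A \<psi> \<Longrightarrow> phases_le C P Y (\<psi> 0)"
  using HN_phases_le_step[of Y n E A \<psi> n] HN_D(3) by force

lemma HN_phases_ge: "HN_filtration C P Y n E A \<psi> \<Longrightarrow> phases_ge C P Y (\<psi> (n - 1))"
  using HN_phases_ge_step[of Y n E A \<psi> n] HN_D(3) by force

text \<open>
  At each step of the filtration the kernel of the induced map on \<open>Hom C Z\<close> comes from
  $\mathrm{Hom}(Z, A_j[-1])$, which vanishes for reasons of phase.
\<close>

lemma HN_first_factor_map:
  assumes HN: "HN_filtration C P Y n E A \<psi>"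
  obtains u where "u \<in> Hom C (A 0) Y"
    and "\<And>Z s a. \<lbrakk>phases_ge C P Z s; s > \<psi> 0 - 1; a \<in> Hom C Z (A 0); u \<cdot>\<^bsub>C\<^esub> a = 0\<rbrakk> \<Longrightarrow> a = 0"
proof -
  have "\<exists>u \<in> Hom C (A 0) (E (Suc j)). \<forall>Z s a. phases_ge C P Z s \<longrightarrow> s > \<psi> 0 - 1 \<longrightarrow>
      a \<in> Hom C Z (A 0) \<longrightarrow> u \<cdot>\<^bsub>C\<^esub> a = 0 \<longrightarrow> a = 0" if "j < n" for j
    using that
  proof (induction j)
    case 0
    obtain f g h where T: "dist C (E 0) (E (Suc 0)) (A 0) f g h" using HN_D(4)[OF HN 0] by blast
    \<comment> \<open>Since \<open>E 0\<close> is zero, \<open>E 1\<close> is a copy of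
      \<open>A 0\<close>; the map starts as this isomorphism and is pushed along the
      filtration.\<close>
    obtain u where u: "is_iso C (A 0) (E (Suc 0)) u" "g \<cdot>\<^bsub>C\<^esub> u = idt C (A 0)"
      using is_iso_inverse[OF dist_zero_source_iso[OF T HN_D(2)[OF HN]]] by metis
    have g: "g \<in> Hom C (E (Suc 0)) (A 0)" using dist_Hom[OF T] by blast
    have uH: "u \<in> Hom C (A 0) (E (Suc 0))" using u unfolding is_iso_def by blast
    have "a = 0" if "a \<in> Hom C Z (A 0)" "u \<cdot>\<^bsub>C\<^esub> a = 0" for Z a
      using cmp_assoc[OF that(1) uH g] that(2) u(2) cmp_zero_right[OF g] cmp_idt_left[OF that(1)]
      by simp
    then show ?case using uH by blast
  next
    case (Suc j)
    obtain f g h where T: "dist C (E (Suc j)) (E (Suc (Suc j))) (A (Suc j)) f g h"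
      using HN_D(4)[OF HN Suc(2)] by blast
    have f: "f \<in> Hom C (E (Suc j)) (E (Suc (Suc j)))" using dist_Hom[OF T] by blast
    obtain u where u: "u \<in> Hom C (A 0) (E (Suc j))"
      and inj: "\<And>Z s a. \<lbrakk>phases_ge C P Z s; s > \<psi> 0 - 1; a \<in> Hom C Z (A 0); u \<cdot>\<^bsub>C\<^esub> a = 0\<rbrakk> \<Longrightarrow> a = 0"
      using Suc by (meson Suc_lessD)
    have "a = 0" if Z: "phases_ge C P Z s" "s > \<psi> 0 - 1" "a \<in> Hom C Z (A 0)"
      "(f \<cdot>\<^bsub>C\<^esub> u) \<cdot>\<^bsub>C\<^esub> a = 0" for Z s a
    proof -
      have "phases_ge C P (sh C 1 Z) (s + 1)" using phases_ge_sh[OF Z(1), of 1] by simp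
      moreover have "\<psi> (Suc j) < s + 1" using HN_D(7)[OF HN _ Suc(2), of 0] Z(2) by simp
      ultimately have "Hom C (sh C 1 Z) (A (Suc j)) = {0}"
        using phases_geD HN_D(5)[OF HN Suc(2)] by blast
      then have "u \<cdot>\<^bsub>C\<^esub> a = 0"
        using dist_cancel_left[OF T cmp_Hom[OF Z(3) u]] cmp_assoc[OF Z(3) u f] Z(4) by simp
      then show ?thesis using inj Z by blast
    qed
    then show ?case using cmp_Hom[OF u f] by blast
  qed
  from this[of "n - 1"] that show thesis using HN_D(1,3)[OF HN] by auto
qed

text \<open>The injectivity of \<open>u\<close> is tested on the identity of \<open>A 0\<close>. The
  result makes the bound \<open>\<psi> 0\<close> sharp, which gives the uniqueness of phi^+.\<close>

lemma HN_first_factor_Hom: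
  assumes HN: "HN_filtration C P Y n E A \<psi>"
  shows "Hom C (A 0) Y \<noteq> {0}"
proof
  assume z: "Hom C (A 0) Y = {0}"
  obtain u where u: "u \<in> Hom C (A 0) Y"
    and inj: "\<And>Z s a. \<lbrakk>phases_ge C P Z s; s > \<psi> 0 - 1; a \<in> Hom C Z (A 0); u \<cdot>\<^bsub>C\<^esub> a = 0\<rbrakk> \<Longrightarrow> a = 0"
    using HN_first_factor_map[OF HN] by blast
  have "phases_ge C P (A 0) (\<psi> 0)" using slice_phases HN_D(1,5)[OF HN] by blast
  then have "idt C (A 0) = 0" using inj[OF _ _ idt_Hom] u z cmp_idt_right[OF u] by force
  then show False using HN_D(1,6)[OF HN] zero_object_iff_idt by blast
qed

lemma HN_last_triangle:
  assumes HN: "HN_filtration C P Y n E A \<psi>"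
  obtains f g h where "dist C (E (n - 1)) Y (A (n - 1)) f g h"
    "phases_ge C P (E (n - 1)) (\<psi> (n - 1))"
  using HN_D(1,3)[OF HN] HN_D(4)[OF HN, of "n - 1"] HN_phases_ge_step[OF HN, of "n - 1"] by auto

text \<open>If the last map \<open>g\<close> were zero, the identity of the last factor would come
  from a map out of \<open>sh C 1 (E (n - 1))\<close>, whose phases are at least
  \<open>\<psi> (n - 1) + 1\<close>.\<close>

lemma HN_last_factor_Hom:
  assumes HN: "HN_filtration C P Y n E A \<psi>"
  shows "Hom C Y (A (n - 1)) \<noteq> {0}"
proof
  assume z: "Hom C Y (A (n - 1)) = {0}"
  obtain f g h where T: "dist C (E (n - 1)) Y (A (n - 1)) f g h"
    and ge: "phases_ge C P (E (n - 1)) (\<psi> (n - 1))" using HN_last_triangle[OF HN] by blast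
  have n: "n - 1 < n" using HN_D(1)[OF HN] by simp
  have "phases_ge C P (sh C 1 (E (n - 1))) (\<psi> (n - 1) + 1)" using phases_ge_sh[OF ge, of 1] by simp
  then have "Hom C (sh C 1 (E (n - 1))) (A (n - 1)) = {0}"
    using phases_geD HN_D(5)[OF HN n] less_add_one by blast
  moreover have "idt C (A (n - 1)) \<cdot>\<^bsub>C\<^esub> g = 0"
    using dist_Hom[OF T] z cmp_idt_left[of g Y "A (n - 1)"] by auto
  ultimately have "idt C (A (n - 1)) = 0" using dist_cancel_right[OF T idt_Hom] by blast
  then show False using HN_D(6)[OF HN n] zero_object_iff_idt by blast
qed

lemma HN_first_phase_le:
  assumes "HN_filtration C P Y n E A \<psi>" "phases_le C P Y t"
  shows "\<psi> 0 \<le> t"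
proof (rule ccontr)
  assume "\<not> \<psi> 0 \<le> t"
  then show False
    using HN_first_factor_Hom[OF assms(1)] HN_D(1)[OF assms(1)] HN_D(5)[OF assms(1), of 0]
      phases_leD[OF assms(2)] by simp
qed

lemma HN_last_phase_ge:
  assumes "HN_filtration C P Y n E A \<psi>" "phases_ge C P Y t"
  shows "t \<le> \<psi> (n - 1)"
proof (rule ccontr)
  assume "\<not> t \<le> \<psi> (n - 1)"
  then show False
    using HN_last_factor_Hom[OF assms(1)] HN_D(1)[OF assms(1)] HN_D(5)[OF assms(1), of "n - 1"]
      phases_geD[OF assms(2)] by simp
qed

text \<open>The top phase of each filtration is an upper bound in the sense of
  \<open>phases_le\<close>, hence bounds the top phase of every other one; so the description in
  \<open>phase_max\<close> picks a unique number.\<close>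

lemma phase_max_HN:
  assumes "HN_filtration C P Y n E A \<psi>"
  shows "phase_max C \<tau> Y = \<psi> 0"
  unfolding phase_max_def
proof (rule the_equality)
  fix t assume "\<exists>n E A \<psi>. HN_filtration C P Y n E A \<psi> \<and> t = \<psi> 0"
  then obtain n' E' A' \<psi>' where HN: "HN_filtration C P Y n' E' A' \<psi>'" and t: "t = \<psi>' 0" by blast
  show "t = \<psi> 0"
    using HN_first_phase_le[OF HN HN_phases_le[OF assms]] HN_first_phase_le[OF assms HN_phases_le[OF HN]]
      t by simp
qed (use assms in blast)

lemma phase_min_HN:
  assumes "HN_filtration C P Y n E A \<psi>"
  shows "phase_min C \<tau> Y = \<psi> (n - 1)"
  unfolding phase_min_def
proof (rule the_equality)
  fix t assume "\<exists>n E A \<psi>. HN_filtration C P Y n E A \<psi> \<and> t = \<psi> (n - 1)"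
  then obtain n' E' A' \<psi>' where HN: "HN_filtration C P Y n' E' A' \<psi>'" and t: "t = \<psi>' (n' - 1)"
    by blast
  show "t = \<psi> (n - 1)"
    using HN_last_phase_ge[OF HN HN_phases_ge[OF assms]] HN_last_phase_ge[OF assms HN_phases_ge[OF HN]]
      t by simp
qed (use assms in blast)

lemma phases_le_phase_max:
  assumes "\<not> zero_object C Y"
  shows "phases_le C P Y (phase_max C \<tau> Y)"
proof -
  obtain n E A \<psi> where HN: "HN_filtration C P Y n E A \<psi>" using ex_HN assms(1) by blast
  show ?thesis using HN_phases_le[OF HN] phase_max_HN[OF HN] by simp
qed

lemma phases_ge_phase_min:
  assumes "\<not> zero_object C Y"
  shows "phases_ge C P Y (phase_min C \<tau> Y)"
proof -
  obtain n E A \<psi> where HN: "HN_filtration C P Y n E A \<psi>" using ex_HN assms(1) by blast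
  show ?thesis using HN_phases_ge[OF HN] phase_min_HN[OF HN] by simp
qed

lemma phase_max_le:
  assumes "\<not> zero_object C Y" "phases_le C P Y t"
  shows "phase_max C \<tau> Y \<le> t"
proof -
  obtain n E A \<psi> where HN: "HN_filtration C P Y n E A \<psi>" using ex_HN assms(1) by blast
  show ?thesis using HN_first_phase_le[OF HN assms(2)] phase_max_HN[OF HN] by simp
qed

lemma phase_min_ge:
  assumes "\<not> zero_object C Y" "phases_ge C P Y t"
  shows "t \<le> phase_min C \<tau> Y"
proof -
  obtain n E A \<psi> where HN: "HN_filtration C P Y n E A \<psi>" using ex_HN assms(1) by blast
  show ?thesis using HN_last_phase_ge[OF HN assms(2)] phase_min_HN[OF HN] by simp
qed

text \<open>\<open>phases_ge\<close> tests against semistable targets only; induction along the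
  filtration of \<open>W\<close> extends the vanishing to \<open>W\<close>, whose factors have
  phases at most \<open>t\<close>.\<close>

lemma Hom_zero_of_phases:
  assumes Z: "phases_ge C P Z s" and W: "phases_le C P W t" and "t < s"
  shows "Hom C Z W = {0}"
proof (cases "zero_object C W")
  case False
  then obtain n E A \<psi> where HN: "HN_filtration C P W n E A \<psi>" using ex_HN by blast
  have "Hom C Z (E j) = {0}" if "j \<le> n" for j
    using that
  proof (induction j)
    case 0
    then show ?case using HN_D(2)[OF HN] unfolding zero_object_def by blast
  next
    case (Suc j)
    obtain f g h where T: "dist C (E j) (E (Suc j)) (A j) f g h" using HN_D(4)[OF HN, of j] Suc by auto
    have "\<psi> j < s"
      using HN_phase_mono[OF HN, of 0 j] Suc.prems HN_first_phase_le[OF HN W] \<open>t < s\<close> by simp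
    then have "Hom C Z (A j) = {0}"
      using phases_geD[OF Z HN_D(5)[OF HN, of j]] Suc.prems by simp
    then show ?case using dist_Hom_middle_target[OF T] Suc by simp
  qed
  then show ?thesis using HN_D(3)[OF HN] by force
qed (simp add: zero_object_def)

lemma HN_constant_phase:
  assumes HN: "HN_filtration C P Z n E A \<psi>" and "\<psi> 0 \<le> t" "t \<le> \<psi> (n - 1)"
  shows "Z \<in> P t"
proof -
  have "n = 1"
    using HN_D(7)[OF HN, of 0 "n - 1"] HN_D(1)[OF HN] assms(2,3) by (cases "n = 1") auto
  then obtain f g h where T: "dist C (E 0) Z (A 0) f g h" using HN_D(3,4)[OF HN] by force
  have "isomorphic C (A 0) Z"
    using dist_zero_source_iso[OF T HN_D(2)[OF HN]] isomorphic_sym unfolding isomorphic_def by blast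
  moreover have "\<psi> 0 = t" using assms(2,3) \<open>n = 1\<close> by simp
  ultimately show ?thesis using iso_slice HN_D(1,5)[OF HN] by blast
qed

text \<open>The two bounds force a single Harder-Narasimhan factor. Hence slices are closed under
  extensions, although a slicing only demands closure under biproducts.\<close>

lemma slice_of_phases:
  assumes "phases_le C P Z t" "phases_ge C P Z t"
  shows "Z \<in> P t"
proof (cases "zero_object C Z")
  case False
  then obtain n E A \<psi> where HN: "HN_filtration C P Z n E A \<psi>" using ex_HN by blast
  show ?thesis
    using HN_constant_phase[OF HN HN_first_phase_le[OF HN assms(1)] HN_last_phase_ge[OF HN assms(2)]] .
qed (rule zero_slice)

lemma slice_extension:
  assumes "dist C A E B f g h" "A \<in> P t" "B \<in> P t"
  shows "E \<in> P t"
  using slice_of_phases phases_le_extension[OF assms(1)] phases_ge_extension[OF assms(1)]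
    slice_phases[OF assms(2)] slice_phases[OF assms(3)] by simp

lemma phase_eq:
  assumes "E \<in> P t" "\<not> zero_object C E"
  shows "phase \<tau> E = t"
  unfolding phase_def
proof (rule the_equality)
  fix s assume "E \<in> P s"
  then have "s < t \<or> t < s \<Longrightarrow> Hom C E E = {0}" using Hom_slice_zero assms(1) by blast
  then show "s = t" using assms(2) idt_Hom[of E] zero_object_iff_idt by force
qed (rule assms(1))

section \<open>Stable subobjects and quotients\<close>

lemma charge_zero: "zero_object C Z \<Longrightarrow> charge \<tau> Z = 0"
  using charge_dist[OF dist_idt] by simp

text \<open>Rotation by \<open>- (pi * t)\<close> moves the ray of phase \<open>t\<close> to the
  positive real axis. On phases in [t, t+1] the imaginary part is then nonnegative and vanishes only
  at the two ends.\<close>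

lemma Im_charge_slice:
  assumes "E \<in> P s" "\<not> zero_object C E"
  obtains m :: real where "m > 0" "Im (charge \<tau> E * cis (- (pi * t))) = m * sin (pi * (s - t))"
proof -
  obtain m :: real where m: "m > 0" "charge \<tau> E = of_real m * exp (\<i> * of_real (pi * s))"
    using charge_slice[OF assms] by blast
  have "charge \<tau> E * cis (- (pi * t)) = of_real m * (cis (pi * s) * cis (- (pi * t)))"
    using m(2) by (simp add: cis_conv_exp ac_simps)
  also have "\<dots> = of_real m * cis (pi * (s - t))"
    by (simp add: cis_mult algebra_simps)
  finally show thesis using that[OF m(1)] by simp
qed

lemma Im_charge_slice_self:
  assumes "E \<in> P t"
  shows "Im (charge \<tau> E * cis (- (pi * t))) = 0"
proof (cases "zero_object C E")
  case False
  then show ?thesis using Im_charge_slice[OF assms False, of t] by auto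
qed (simp add: charge_zero)

lemma HN_charge:
  assumes HN: "HN_filtration C P Y n E A \<psi>" and "j \<le> n"
  shows "charge \<tau> (E j) = (\<Sum>i<j. charge \<tau> (A i))"
  using assms(2)
proof (induction j)
  case 0
  then show ?case using charge_zero HN_D(2)[OF HN] by simp
next
  case (Suc j)
  then show ?case using HN_D(4)[OF HN, of j] charge_dist by fastforce
qed

text \<open>
  The phases of the cone lie in $[t, t+1]$ and its charge lies on the line of phase \<open>t\<close>, so
  only the phases \<open>t\<close> and \<open>t + 1\<close> occur; being mono excludes \<open>t + 1\<close>.
\<close>

lemma mono_slice_cone:
  assumes mono: "mono_in C (P t) A B f" and T: "dist C A B Z f g h"
  shows "Z \<in> P t"
proof (cases "zero_object C Z")
  case False
  then obtain n E F \<psi> where HN: "HN_filtration C P Z n E F \<psi>" using ex_HN by blast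
  have A: "A \<in> P t" and B: "B \<in> P t" and f: "f \<in> Hom C A B"
    using mono unfolding mono_in_def by auto
  have n: "0 < n" using HN_D(1)[OF HN] .
  have A1: "sh C 1 A \<in> P (t + 1)" using sh_slice[OF A, of 1] by simp
  note R = dist_rotated[OF T]
  have "phases_le C P Z (t + 1)" "phases_ge C P Z t"
    using phases_le_extension[OF R] phases_ge_extension[OF R] slice_phases[OF B] slice_phases[OF A1]
      phases_le_mono[of B t "t + 1"] phases_ge_mono[of "sh C 1 A" "t + 1" t] by auto
  then have top: "\<psi> 0 \<le> t + 1" and bot: "t \<le> \<psi> (n - 1)"
    using HN_first_phase_le[OF HN] HN_last_phase_ge[OF HN] by auto
  have range: "t \<le> \<psi> j \<and> \<psi> j \<le> t + 1" if "j < n" for j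
    using HN_phase_mono[OF HN, of 0 j] HN_phase_mono[OF HN, of j "n - 1"] top bot that by force
  let ?I = "\<lambda>E. Im (charge \<tau> E * cis (- (pi * t)))"
  have nonneg: "0 \<le> ?I (F j)" if j: "j < n" for j
  proof -
    obtain m where "m > 0" "?I (F j) = m * sin (pi * (\<psi> j - t))"
      using Im_charge_slice[OF HN_D(5,6)[OF HN j]] by blast
    moreover have "0 \<le> sin (pi * (\<psi> j - t))" using range[OF j] by (intro sin_ge_zero) auto
    ultimately show ?thesis by simp
  qed
  have "?I B = ?I A + ?I Z" using charge_dist[OF T] by (simp add: distrib_right)
  then have "?I Z = 0" using Im_charge_slice_self A B by simp
  moreover have "?I Z = (\<Sum>j<n. ?I (F j))"
    using HN_charge[OF HN, of n] HN_D(3)[OF HN] by (simp only: le_refl sum_distrib_right Im_sum)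
  \<comment> \<open>The nonnegative contributions of the factors sum to zero. The top factor decides
    the matter: once its phase is \<open>t\<close>, the lower bound \<open>bot\<close> leaves no
    other phase.\<close>
  ultimately have "?I (F 0) = 0" using sum_nonneg_eq_0_iff[of "{..<n}" "\<lambda>j. ?I (F j)"] nonneg n by simp
  then have "sin (pi * (\<psi> 0 - t)) = 0"
    using Im_charge_slice[OF HN_D(5,6)[OF HN n], of t] by fastforce
  then have "\<not> (0 < pi * (\<psi> 0 - t) \<and> pi * (\<psi> 0 - t) < pi)" using sin_gt_zero by force
  then have cases: "\<psi> 0 = t \<or> \<psi> 0 = t + 1"
    using range[OF n] by (auto simp: zero_less_mult_iff)
  have "\<psi> 0 \<noteq> t + 1"
  proof
    assume top: "\<psi> 0 = t + 1"
    obtain a where a: "a \<in> Hom C (F 0) Z" "a \<noteq> 0"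
      using HN_first_factor_Hom[OF HN] zero_Hom by blast
    \<comment> \<open>A top factor of phase t+1 is K[1] with \<open>K\<close> in the slice. The
      composite K[1] -> Z -> A[1] is the shift of some \<open>k\<close> killed by \<open>f\<close>,
      so \<open>k = 0\<close>; then \<open>a\<close> lifts to a map \<open>F 0\<close> -> B, which
      vanishes by phase.\<close>
    define K where "K = sh C (-1) (F 0)"
    have K: "K \<in> P t" and F: "F 0 = sh C 1 K"
      using sh_slice[OF HN_D(5)[OF HN n], of "-1"] top sh_neg_sh(2)[of 1 "F 0"] by (auto simp: K_def)
    have h: "h \<in> Hom C Z (sh C 1 A)" and g: "g \<in> Hom C B Z" using dist_Hom[OF T] by auto
    have ha: "h \<cdot>\<^bsub>C\<^esub> a \<in> Hom C (sh C 1 K) (sh C 1 A)" using cmp_Hom[OF a(1) h] F by simp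
    define k where "k = shm C (-1) (h \<cdot>\<^bsub>C\<^esub> a)"
    have k: "k \<in> Hom C K A" and k1: "shm C 1 k = h \<cdot>\<^bsub>C\<^esub> a"
      using shm_Hom[OF ha, of "-1"] sh_neg_sh(1)[of 1] shm_neg_shm(2)[OF ha, of 1]
      by (auto simp: k_def)
    have f1: "shm C 1 f \<in> Hom C (sh C 1 A) (sh C 1 B)" using shm_Hom[OF f] .
    have "(- shm C 1 f) \<cdot>\<^bsub>C\<^esub> h = 0" using dist_cmp_zero[OF dist_rotated[OF R]] .
    then have "shm C 1 f \<cdot>\<^bsub>C\<^esub> h = 0" using cmp_uminus_left[OF h f1] by simp
    then have "shm C 1 (f \<cdot>\<^bsub>C\<^esub> k) = 0"
      using shm_cmp[OF k f, of 1] k1 cmp_assoc[OF a(1) h f1] cmp_zero_left[OF a(1)] by simp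
    then have "f \<cdot>\<^bsub>C\<^esub> k = f \<cdot>\<^bsub>C\<^esub> 0"
      using shm_neg_shm(1)[OF cmp_Hom[OF k f], of 1] cmp_zero_right[OF f] by (simp add: shm_0)
    then have "k = 0" using mono K k zero_Hom[of K A] unfolding mono_in_def by blast
    then have "h \<cdot>\<^bsub>C\<^esub> a = 0" using k1 by (simp add: shm_0)
    then obtain b where b: "b \<in> Hom C (F 0) B" "a = g \<cdot>\<^bsub>C\<^esub> b" using dist_lift[OF R a(1)] by blast
    have "Hom C (F 0) B = {0}" using Hom_slice_zero[of t "t + 1"] HN_D(5)[OF HN n] top B by simp
    then show False using b a(2) cmp_zero_right[OF g] by auto
  qed
  then show ?thesis using HN_constant_phase[OF HN _ bot] cases by simp
qed (rule zero_slice)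

text \<open>The third vertex serves as the quotient B/A inside the slice.\<close>

lemma mono_slice_triangle:
  assumes "mono_in C (P t) A B f"
  obtains Z g h where "dist C A B Z f g h" "Z \<in> P t"
  using assms ex_cone[of f A B] mono_slice_cone unfolding mono_in_def by blast

lemma mono_in_compose:
  assumes "mono_in C S A B f" "mono_in C S B D g"
  shows "mono_in C S A D (g \<cdot>\<^bsub>C\<^esub> f)"
proof -
  have f: "f \<in> Hom C A B" and g: "g \<in> Hom C B D" using assms unfolding mono_in_def by auto
  have "u = v" if u: "W \<in> S" "u \<in> Hom C W A" "v \<in> Hom C W A"
    and e: "(g \<cdot>\<^bsub>C\<^esub> f) \<cdot>\<^bsub>C\<^esub> u = (g \<cdot>\<^bsub>C\<^esub> f) \<cdot>\<^bsub>C\<^esub> v" for W u v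
  proof -
    have "g \<cdot>\<^bsub>C\<^esub> (f \<cdot>\<^bsub>C\<^esub> u) = g \<cdot>\<^bsub>C\<^esub> (f \<cdot>\<^bsub>C\<^esub> v)"
      using e cmp_assoc[OF u(2) f g] cmp_assoc[OF u(3) f g] by simp
    then have "f \<cdot>\<^bsub>C\<^esub> u = f \<cdot>\<^bsub>C\<^esub> v"
      using assms(2) u(1) cmp_Hom[OF u(2) f] cmp_Hom[OF u(3) f] unfolding mono_in_def by blast
    then show ?thesis using assms(1) u unfolding mono_in_def by blast
  qed
  then show ?thesis using assms cmp_Hom[OF f g] unfolding mono_in_def by auto
qed

text \<open>The kernel of composition with \<open>f\<close> comes from Hom(W[1], Z), which goes from
  phase t+1 to phase t.\<close>

lemma dist_mono_slice:
  assumes T: "dist C A B Z f g h" and "A \<in> P t" "B \<in> P t" "Z \<in> P t"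
  shows "mono_in C (P t) A B f"
  unfolding mono_in_def
proof (intro conjI ballI impI)
  show f: "f \<in> Hom C A B" using dist_Hom[OF T] by blast
  fix W u v assume W: "W \<in> P t" and u: "u \<in> Hom C W A" "v \<in> Hom C W A" "f \<cdot>\<^bsub>C\<^esub> u = f \<cdot>\<^bsub>C\<^esub> v"
  have "Hom C (sh C 1 W) Z = {0}"
    using Hom_slice_zero[of t "t + 1"] sh_slice[OF W, of 1] assms(4) by simp
  then have "u - v = 0"
    using dist_cancel_left[OF T diff_Hom[OF u(1,2)]] cmp_diff_right[OF u(1,2) f] u(3) by simp
  then show "u = v" by simp
qed (use assms in auto)

lemma interval_cat_phases:
  assumes "W \<in> interval_cat C P {a<..<b}"
  shows "phases_ge C P W a"
  using assms
proof (induction rule: interval_cat.induct)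
  case (zero E)
  then show ?case unfolding phases_ge_def zero_object_def by blast
next
  case (slice s E)
  then show ?case using phases_ge_mono[OF slice_phases(2)[OF slice(2)], of a] by simp
next
  case (extension A B E f g h)
  then show ?case using phases_ge_extension by blast
qed

text \<open>This carries chains of subobjects in a slice over to local finiteness. The triangle
  shows \<open>f\<close> as a kernel of \<open>g\<close>: lifts exist by exactness, and they are
  unique because W[1] has phases at least t - r + 1 > t and so no maps to \<open>Z\<close>.\<close>

lemma mono_slice_strict_mono:
  assumes mono: "mono_in C (P t) A B f" and "0 < r" "r < 1/2"
  shows "strict_mono_in C (interval_cat C P {t - r<..<t + r}) A B f"
proof -
  let ?S = "interval_cat C P {t - r<..<t + r}"
  obtain Z g h where T: "dist C A B Z f g h" and Z: "Z \<in> P t" using mono_slice_triangle[OF mono] .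
  have PS: "E \<in> ?S" if "E \<in> P t" for E using that assms(2) by (intro interval_cat.slice[of t]) auto
  have H: "f \<in> Hom C A B" "g \<in> Hom C B Z" using dist_Hom[OF T] by auto
  have "\<exists>!u. u \<in> Hom C W A \<and> f \<cdot>\<^bsub>C\<^esub> u = w" if W: "W \<in> ?S" and w: "w \<in> Hom C W B" "g \<cdot>\<^bsub>C\<^esub> w = 0" for W w
  proof -
    obtain b where b: "b \<in> Hom C W A" "w = f \<cdot>\<^bsub>C\<^esub> b" using dist_lift[OF T w] by blast
    have "phases_ge C P (sh C 1 W) (t - r + 1)"
      using phases_ge_sh[OF interval_cat_phases[OF W], of 1] by simp
    then have "Hom C (sh C 1 W) Z = {0}" using phases_geD[OF _ Z] assms(3) by simp
    then have "u - v = 0" if "u \<in> Hom C W A" "v \<in> Hom C W A" "f \<cdot>\<^bsub>C\<^esub> u = f \<cdot>\<^bsub>C\<^esub> v" for u v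
      using dist_cancel_left[OF T diff_Hom[OF that(1,2)]] cmp_diff_right[OF that(1,2) H(1)] that(3)
      by simp
    then have "u = v" if "u \<in> Hom C W A" "v \<in> Hom C W A" "f \<cdot>\<^bsub>C\<^esub> u = f \<cdot>\<^bsub>C\<^esub> v" for u v
      using that by force
    then show ?thesis using b by blast
  qed
  then have "kernel_in C ?S A B Z f g"
    unfolding kernel_in_def using PS mono Z H dist_cmp_zero[OF T] unfolding mono_in_def by auto
  then show ?thesis unfolding strict_mono_in_def by blast
qed

lemma descending_chain_has_iso:
  assumes "\<And>n::nat. mono_in C (P t) (A n) B (i n)"
    and "\<And>n. j n \<in> Hom C (A (Suc n)) (A n)" "\<And>n. i n \<cdot>\<^bsub>C\<^esub> j n = i (Suc n)"
  shows "\<exists>n. is_iso C (A (Suc n)) (A n) (j n)"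
proof -
  obtain r where "0 < r" "r < 1/2" and fl: "finite_length C (interval_cat C P {t - r<..<t + r})"
    using locally_finite unfolding locally_finite_def by blast
  then have "\<forall>n. strict_mono_in C (interval_cat C P {t - r<..<t + r}) (A n) B (i n) \<and>
      j n \<in> Hom C (A (Suc n)) (A n) \<and> i n \<cdot>\<^bsub>C\<^esub> j n = i (Suc n)"
    using mono_slice_strict_mono assms by blast
  with fl have "\<exists>N::nat. \<forall>n\<ge>N. is_iso C (A (Suc n)) (A n) (j n)"
    unfolding finite_length_def by blast
  then show ?thesis by blast
qed

lemma ascending_chain_has_iso:
  assumes "\<And>n::nat. mono_in C (P t) (A n) B (i n)"
    and "\<And>n. j n \<in> Hom C (A n) (A (Suc n))" "\<And>n. i (Suc n) \<cdot>\<^bsub>C\<^esub> j n = i n"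
  shows "\<exists>n. is_iso C (A n) (A (Suc n)) (j n)"
proof -
  obtain r where "0 < r" "r < 1/2" and fl: "finite_length C (interval_cat C P {t - r<..<t + r})"
    using locally_finite unfolding locally_finite_def by blast
  then have "\<forall>n. strict_mono_in C (interval_cat C P {t - r<..<t + r}) (A n) B (i n) \<and>
      j n \<in> Hom C (A n) (A (Suc n)) \<and> i (Suc n) \<cdot>\<^bsub>C\<^esub> j n = i n"
    using mono_slice_strict_mono assms by blast
  with fl have "\<exists>N::nat. \<forall>n\<ge>N. is_iso C (A n) (A (Suc n)) (j n)"
    unfolding finite_length_def by blast
  then show ?thesis by blast
qed

lemma not_stable_mono:
  assumes "A \<in> P t" "\<not> zero_object C A" "\<not> stable_object C \<tau> A"
  obtains A' m where "mono_in C (P t) A' A m" "\<not> zero_object C A'" "\<not> is_iso C A' A m"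
  using assms phase_eq[OF assms(1,2)] unfolding stable_object_def semistable_def by auto

text \<open>If no nonzero subobject were stable, each would contain a smaller nonzero one, and
  dependent choice would give a descending chain without a single isomorphism. \<open>R\<close>
  collects the nonzero subobjects with their inclusions, \<open>L\<close> the proper inclusions
  between them.\<close>

lemma ex_stable_subobject:
  assumes Q: "Q \<in> P t" "\<not> zero_object C Q"
  shows "\<exists>A i. mono_in C (P t) A Q i \<and> \<not> zero_object C A \<and> stable_object C \<tau> A"
proof (rule ccontr)
  assume no: "\<not> ?thesis"
  define R where "R = (\<lambda>x. mono_in C (P t) (fst x) Q (snd x) \<and> \<not> zero_object C (fst x))"
  define L where "L = (\<lambda>x y. \<exists>j. j \<in> Hom C (fst y) (fst x) \<and> snd x \<cdot>\<^bsub>C\<^esub> j = snd y \<and>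
    \<not> is_iso C (fst y) (fst x) j)"
  have "mono_in C (P t) Q Q (idt C Q)"
    unfolding mono_in_def using Q idt_Hom cmp_idt_left by metis
  then have start: "R (Q, idt C Q)" using Q unfolding R_def by simp
  have step: "\<exists>y. R y \<and> L x y" if "R x" for x
  proof -
    have m: "mono_in C (P t) (fst x) Q (snd x)" "\<not> zero_object C (fst x)"
      using that unfolding R_def by auto
    then obtain A' k where k: "mono_in C (P t) A' (fst x) k" "\<not> zero_object C A'"
      "\<not> is_iso C A' (fst x) k"
      using no not_stable_mono[of "fst x" t] unfolding mono_in_def by metis
    then have "R (A', snd x \<cdot>\<^bsub>C\<^esub> k)" "L x (A', snd x \<cdot>\<^bsub>C\<^esub> k)"
      using mono_in_compose[OF k(1) m(1)] unfolding R_def L_def mono_in_def by auto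
    then show ?thesis by blast
  qed
  have "\<exists>F. \<forall>n::nat. R (F n) \<and> L (F n) (F (Suc n))"
    by (rule dependent_nat_choice) (use start step in blast)+
  then obtain F where F: "\<And>n::nat. R (F n)" "\<And>n. L (F n) (F (Suc n))" by blast
  obtain j where j: "\<And>n. j n \<in> Hom C (fst (F (Suc n))) (fst (F n)) \<and>
      snd (F n) \<cdot>\<^bsub>C\<^esub> j n = snd (F (Suc n)) \<and> \<not> is_iso C (fst (F (Suc n))) (fst (F n)) (j n)"
    using F(2) unfolding L_def by metis
  have "\<exists>n. is_iso C (fst (F (Suc n))) (fst (F n)) (j n)"
    by (rule descending_chain_has_iso[of t _ Q "\<lambda>n. snd (F n)"]) (use F j in \<open>auto simp: R_def\<close>)
  then show False using j by blast
qed

text \<open>The quotient by a maximal proper subobject is stable.\<close>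

lemma ex_stable_quotient:
  assumes Q: "Q \<in> P t" "\<not> zero_object C Q"
  shows "\<exists>K D i p h. dist C K Q D i p h \<and> K \<in> P t \<and> D \<in> P t \<and> \<not> zero_object C D \<and>
    stable_object C \<tau> D"
proof (rule ccontr)
  assume no: "\<not> ?thesis"
  define R where "R = (\<lambda>x. mono_in C (P t) (fst x) Q (snd x) \<and> \<not> is_iso C (fst x) Q (snd x))"
  define L where "L = (\<lambda>x y. \<exists>j. j \<in> Hom C (fst x) (fst y) \<and> snd y \<cdot>\<^bsub>C\<^esub> j = snd x \<and>
    \<not> is_iso C (fst x) (fst y) j)"
  obtain O' where O': "zero_object C O'" using ex_zero_object by blast
  have "mono_in C (P t) O' Q 0"
    unfolding mono_in_def using Q zero_slice[OF O'] zero_Hom O' unfolding zero_object_def by auto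
  moreover have "\<not> is_iso C O' Q 0"
    using zero_object_iso[of O' Q] O' Q(2) unfolding isomorphic_def by blast
  ultimately have start: "R (O', 0)" unfolding R_def by simp
  have step: "\<exists>y. R y \<and> L x y" if "R x" for x
  proof -
    obtain K i where x: "x = (K, i)" by (cases x)
    have m: "mono_in C (P t) K Q i" "\<not> is_iso C K Q i" using that unfolding R_def x by auto
    obtain D p h where T: "dist C K Q D i p h" and D: "D \<in> P t" using mono_slice_triangle[OF m(1)] .
    have K: "K \<in> P t" using m(1) unfolding mono_in_def by blast
    have D0: "\<not> zero_object C D" using dist_iso_iff_cone_zero[OF T] m(2) by blast
    then have "\<not> stable_object C \<tau> D" using no T K D by blast
    \<comment> \<open>The proper nonzero subobject \<open>A\<close> of D = Q/K is pulled back to a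
      subobject of \<open>Q\<close> strictly between \<open>K\<close> and \<open>Q\<close>.\<close>
    then obtain A k where k: "mono_in C (P t) A D k" "\<not> zero_object C A" "\<not> is_iso C A D k"
      using not_stable_mono[OF D D0] by metis
    obtain F q d where T2: "dist C A D F k q d" and F: "F \<in> P t" using mono_slice_triangle[OF k(1)] .
    have p: "p \<in> Hom C Q D" and q: "q \<in> Hom C D F" using dist_Hom[OF T] dist_Hom[OF T2] by auto
    obtain Y' r s where T3: "dist C Q F Y' (q \<cdot>\<^bsub>C\<^esub> p) r s" using ex_cone[OF cmp_Hom[OF p q]] by blast
    have i: "i \<in> Hom C K Q" and s: "s \<in> Hom C Y' (sh C 1 Q)" and r: "r \<in> Hom C F Y'"
      using dist_Hom[OF T] dist_Hom[OF T3] by auto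
    \<comment> \<open>The cone \<open>Y'\<close> of Q -> D -> F is the shifted kernel of this
      composite. The octahedral axiom presents it as an extension of A[1] by K[1], which places it
      in phase t+1.\<close>
    obtain u v w where T4: "dist C (sh C 1 K) Y' (sh C 1 A) u v w" and su: "s \<cdot>\<^bsub>C\<^esub> u = - shm C 1 i"
      using octahedral[OF dist_rotated[OF T] dist_rotated[OF T2] T3] by blast
    have u: "u \<in> Hom C (sh C 1 K) Y'" using dist_Hom[OF T4] by blast
    have A: "A \<in> P t" using k(1) unfolding mono_in_def by blast
    have "Y' \<in> P (t + 1)"
      using slice_extension[OF T4, of "t + 1"] sh_slice[OF K, of 1] sh_slice[OF A, of 1] by simp
    define K' where "K' = sh C (-1) Y'"
    \<comment> \<open>The sign cancels the one that rotation of triangles introduces.\<close>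
    define i' where "i' = - shm C (-1) s"
    define j where "j = shm C (-1) u"
    have K': "K' \<in> P t" and shK': "sh C 1 K' = Y'"
      using sh_slice[OF \<open>Y' \<in> P (t + 1)\<close>, of "-1"] sh_neg_sh(2)[of 1 Y'] unfolding K'_def by auto
    have s': "shm C (-1) s \<in> Hom C K' Q"
      using shm_Hom[OF s, of "-1"] sh_neg_sh(1)[of 1 Q] unfolding K'_def by simp
    have i'H: "i' \<in> Hom C K' Q" unfolding i'_def using uminus_Hom[OF s'] .
    have j: "j \<in> Hom C K K'"
      using shm_Hom[OF u, of "-1"] sh_neg_sh(1)[of 1 K] unfolding K'_def j_def by simp
    have u1: "shm C 1 j = u" using shm_neg_shm(2)[OF u, of 1] unfolding j_def by simp
    have s1: "- shm C 1 i' = s"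
      using shm_neg_shm(2)[OF s, of 1] shm_uminus[OF s', of 1] unfolding i'_def by simp
    have T5: "dist C K' Q F i' (q \<cdot>\<^bsub>C\<^esub> p) r"
      using dist_rotate[OF i'H cmp_Hom[OF p q], of r] r T3 shK' s1 by simp
    have i'j: "i' \<cdot>\<^bsub>C\<^esub> j = i"
    proof -
      have "i' \<cdot>\<^bsub>C\<^esub> j = - shm C (-1) (s \<cdot>\<^bsub>C\<^esub> u)"
        using cmp_uminus_left[OF j s'] shm_cmp[OF u s, of "-1"] unfolding i'_def j_def by simp
      also have "\<dots> = i"
        using su shm_neg_shm(1)[OF i, of 1] shm_uminus[OF shm_Hom[OF i, of 1], of "-1"] by simp
      finally show ?thesis .
    qed
    have "\<not> zero_object C F" using k(3) dist_iso_iff_cone_zero[OF T2] by blast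
    \<comment> \<open>The enlarged subobject is still proper since Q/K' is \<open>F\<close>, and it
      is larger than \<open>K\<close> since K'/K is \<open>A\<close>; neither is zero.\<close>
    then have "\<not> is_iso C K' Q i'" using dist_iso_iff_cone_zero[OF T5] by blast
    then have "R (K', i')" unfolding R_def using dist_mono_slice[OF T5 K' Q(1) F] by simp
    moreover have "\<not> is_iso C K K' j"
    proof
      assume "is_iso C K K' j"
      then have "zero_object C (sh C 1 A)"
        using is_iso_shm[of K K' j 1] shK' u1 dist_iso_iff_cone_zero[OF T4] by simp
      then have "zero_object C A" using zero_object_sh[of "sh C 1 A" "-1"] sh_neg_sh(1)[of 1 A] by simp
      then show False using k(2) by blast
    qed
    ultimately show ?thesis unfolding L_def x using i'j j by (intro exI[of _ "(K', i')"]) auto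
  qed
  have "\<exists>F. \<forall>n::nat. R (F n) \<and> L (F n) (F (Suc n))"
    by (rule dependent_nat_choice) (use start step in blast)+
  then obtain F where F: "\<And>n::nat. R (F n)" "\<And>n. L (F n) (F (Suc n))" by blast
  obtain j where j: "\<And>n. j n \<in> Hom C (fst (F n)) (fst (F (Suc n))) \<and>
      snd (F (Suc n)) \<cdot>\<^bsub>C\<^esub> j n = snd (F n) \<and> \<not> is_iso C (fst (F n)) (fst (F (Suc n))) (j n)"
    using F(2) unfolding L_def by metis
  have "\<exists>n. is_iso C (fst (F n)) (fst (F (Suc n))) (j n)"
    by (rule ascending_chain_has_iso[of t _ Q "\<lambda>n. snd (F n)"]) (use F j in \<open>auto simp: R_def\<close>)
  then show False using j by blast
qed

section \<open>Vanishing of the extreme morphisms\<close>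

lemma Hom_stable_to_shift_zero:
  assumes Y: "\<not> zero_object C Y" and neg: "\<And>j. j < 0 \<Longrightarrow> hom C j Y Y = {0}"
    and m: "m < 0" "phase_max C \<tau> Y + m < phase_min C \<tau> Y + 1"
    and uniq: "\<And>D. D \<in> P (phase_min C \<tau> Y) \<Longrightarrow> \<not> zero_object C D \<Longrightarrow> stable_object C \<tau> D
      \<Longrightarrow> isomorphic C D X"
  shows "hom C m X Y = {0}"
proof -
  obtain n E A \<psi> where HN: "HN_filtration C P Y n E A \<psi>" using ex_HN Y by blast
  define t where "t = phase_min C \<tau> Y"
  have t: "t = \<psi> (n - 1)" unfolding t_def using phase_min_HN[OF HN] .
  let ?V = "sh C m Y"
  have V: "phases_le C P ?V (phase_max C \<tau> Y + m)" using phases_le_sh[OF phases_le_phase_max[OF Y]] .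
  obtain f g h where T: "dist C (E (n - 1)) Y (A (n - 1)) f g h"
    and E: "phases_ge C P (E (n - 1)) t" using HN_last_triangle[OF HN] t by metis
  have Q: "A (n - 1) \<in> P t" "\<not> zero_object C (A (n - 1))"
    using HN_D(1)[OF HN] HN_D(5,6)[OF HN, of "n - 1"] t by auto
  obtain K D i p d where T2: "dist C K (A (n - 1)) D i p d" and K: "K \<in> P t" and D: "D \<in> P t"
    "\<not> zero_object C D" "stable_object C \<tau> D" using ex_stable_quotient[OF Q] by blast
  have g: "g \<in> Hom C Y (A (n - 1))" and p: "p \<in> Hom C (A (n - 1)) D"
    using dist_Hom[OF T] dist_Hom[OF T2] by auto
  \<comment> \<open>The fibre of Y -> D is not formed: the two maps Y -> A(n-1) -> D are cancelled
    one after the other. Their fibres \<open>E (n - 1)\<close> and \<open>K\<close> both have phases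
    at least \<open>t\<close>, so this one vanishing serves both.\<close>
  have vanish: "Hom C (sh C 1 Z) ?V = {0}" if "phases_ge C P Z t" for Z
    using Hom_zero_of_phases[OF phases_ge_sh[OF that, of 1] V] m(2) by (simp add: t_def)
  have "a = 0" if a: "a \<in> Hom C D ?V" for a
  proof -
    have ap: "a \<cdot>\<^bsub>C\<^esub> p \<in> Hom C (A (n - 1)) ?V" using cmp_Hom[OF p a] .
    have "(a \<cdot>\<^bsub>C\<^esub> p) \<cdot>\<^bsub>C\<^esub> g = 0" using cmp_Hom[OF g ap] neg[OF m(1)] by blast
    then have "a \<cdot>\<^bsub>C\<^esub> p = 0" using dist_cancel_right[OF T ap _ vanish[OF E]] by blast
    then show ?thesis using dist_cancel_right[OF T2 a _ vanish[OF slice_phases(2)[OF K]]] by blast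
  qed
  then have "Hom C D ?V = {0}" using zero_Hom by blast
  then show ?thesis using Hom_eq_zero_iso_source uniq D unfolding t_def by blast
qed

lemma Hom_to_shift_stable_zero:
  assumes Y: "\<not> zero_object C Y" and neg: "\<And>j. j < 0 \<Longrightarrow> hom C j Y Y = {0}"
    and m: "m < 0" "phase_max C \<tau> Y + m < phase_min C \<tau> Y + 1"
    and uniq: "\<And>D. D \<in> P (phase_max C \<tau> Y) \<Longrightarrow> \<not> zero_object C D \<Longrightarrow> stable_object C \<tau> D
      \<Longrightarrow> isomorphic C D X"
  shows "hom C m Y X = {0}"
proof -
  obtain n E A \<psi> where HN: "HN_filtration C P Y n E A \<psi>" using ex_HN Y by blast
  define t where "t = phase_max C \<tau> Y"
  have t: "t = \<psi> 0" unfolding t_def using phase_max_HN[OF HN] .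
  \<comment> \<open>The shift is moved to the source, so that a map to \<open>D\<close> can be
    continued by D -> A 0 -> Y to an element of Hom(Y[-m], Y), which is Hom^m(Y,Y) up to
    shift.\<close>
  let ?Z = "sh C (- m) Y"
  define s where "s = phase_min C \<tau> Y - m"
  have Z: "phases_ge C P ?Z s"
    using phases_ge_sh[OF phases_ge_phase_min[OF Y], of "- m"] by (simp add: s_def)
  \<comment> \<open>The assumption on \<open>m\<close> is exactly the phase threshold for
    injectivity of A 0 -> Y; it also gives s + 1 > t, which makes D -> A 0 cancellable.\<close>
  have s: "s > t - 1" using m(2) by (simp add: s_def t_def)
  obtain u where u: "u \<in> Hom C (A 0) Y"
    and inj: "\<And>Z s a. \<lbrakk>phases_ge C P Z s; s > t - 1; a \<in> Hom C Z (A 0); u \<cdot>\<^bsub>C\<^esub> a = 0\<rbrakk> \<Longrightarrow> a = 0"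
    using HN_first_factor_map[OF HN] t by blast
  have Q: "A 0 \<in> P t" "\<not> zero_object C (A 0)"
    using HN_D(1)[OF HN] HN_D(5,6)[OF HN, of 0] t by auto
  obtain D i where mono: "mono_in C (P t) D (A 0) i" and D0: "\<not> zero_object C D"
    and st: "stable_object C \<tau> D" using ex_stable_subobject[OF Q] by blast
  have D: "D \<in> P t" and i: "i \<in> Hom C D (A 0)" using mono unfolding mono_in_def by auto
  obtain F g h where T: "dist C D (A 0) F i g h" and F: "F \<in> P t" using mono_slice_triangle[OF mono] .
  have v: "Hom C (sh C 1 ?Z) F = {0}"
    using phases_geD[OF phases_ge_sh[OF Z, of 1] F] s by simp
  have "Hom C ?Z Y = {0}"
    using neg[OF m(1)] Hom_sh_eq_zero_iff[of m ?Z Y] sh_neg_sh(2)[of m Y] by simp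
  have "a = 0" if a: "a \<in> Hom C ?Z D" for a
  proof -
    have ia: "i \<cdot>\<^bsub>C\<^esub> a \<in> Hom C ?Z (A 0)" using cmp_Hom[OF a i] .
    have "u \<cdot>\<^bsub>C\<^esub> (i \<cdot>\<^bsub>C\<^esub> a) = 0" using cmp_Hom[OF ia u] \<open>Hom C ?Z Y = {0}\<close> by blast
    then have "i \<cdot>\<^bsub>C\<^esub> a = 0" using inj[OF Z s ia] by blast
    then show ?thesis using dist_cancel_left[OF T a _ v] by blast
  qed
  then have "Hom C ?Z D = {0}" using zero_Hom by blast
  moreover have "isomorphic C D X" using uniq D D0 st unfolding t_def by blast
  ultimately have "Hom C ?Z X = {0}" using Hom_eq_zero_iso_target by blast
  then show ?thesis using Hom_sh_eq_zero_iff[of m ?Z X] sh_neg_sh(2)[of m Y] by simp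
qed

end

section \<open>Duality, twists and the conclusion\<close>

context klinear_category
begin

text \<open>Functionals are normalised to vanish outside their subspace, so the dual of
  \<open>{0}\<close> has a single element, and injectivity of the duality map leaves room for only
  one morphism.\<close>

lemma two_calabi_yau_Hom_zero:
  assumes "two_calabi_yau C" "hom C (2 - i) Y X = {0}"
  shows "hom C i X Y = {0}"
proof -
  obtain \<eta> :: "int \<Rightarrow> 'o \<Rightarrow> 'o \<Rightarrow> 'm \<Rightarrow> 'm \<Rightarrow> 'k"
    where "\<forall>i X Y. bij_betw (\<eta> i X Y) (hom C i X Y) (dual C (hom C (2 - i) Y X))"
    using assms(1) unfolding two_calabi_yau_def by (elim exE conjE) (rule that)
  then have b: "bij_betw (\<eta> i X Y) (hom C i X Y) (dual C (hom C (2 - i) Y X))" by blast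
  have "l = l'" if "l \<in> dual C {0}" "l' \<in> dual C {0}" for l l' :: "'m \<Rightarrow> 'k"
  proof
    have z: "k x = 0" if "k \<in> dual C {0}" for x and k :: "'m \<Rightarrow> 'k"
    proof (cases "x = 0")
      case True
      have "k (0 + 0) = k 0 + k 0" using that unfolding dual_def by blast
      then have "k 0 = 0" by (metis add_0_left add_cancel_right_right)
      then show ?thesis using True by simp
    qed (use that in \<open>auto simp: dual_def\<close>)
    show "l x = l' x" for x using z[OF that(1)] z[OF that(2)] by simp
  qed
  then have "f = 0" if "f \<in> hom C i X Y" for f
    using bij_betw_apply[OF b that] bij_betw_apply[OF b zero_Hom] assms(2)
      bij_betw_imp_inj_on[OF b] that zero_Hom unfolding inj_on_def by metis
  then show ?thesis using zero_Hom by blast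
qed

lemma is_basis_nonzero: "is_basis C V B \<Longrightarrow> b \<in> B \<Longrightarrow> b \<in> V \<and> b \<noteq> 0"
  unfolding is_basis_def using vs.dependent_zero vs.span_base by blast

lemma zero_object_functor:
  assumes F: "klinear_functor C F" and X: "zero_object C X"
  shows "zero_object C (fobj F X)"
proof -
  have add: "farr F (f + g) = farr F f + farr F g" if "f \<in> Hom C X X" "g \<in> Hom C X X" for f g
    using F that unfolding klinear_functor_def by blast
  have "farr F 0 = 0" using add[OF zero_Hom zero_Hom] by simp
  moreover have "farr F (idt C X) = idt C (fobj F X)" using F unfolding klinear_functor_def by blast
  ultimately show ?thesis using X by (simp add: zero_object_iff_idt)
qed

text \<open>The phases of the twisted objects have meaning only for nonzero objects; the
  quasi-inverse recovers \<open>Y\<close> up to isomorphism.\<close>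

lemma autoequivalence_nonzero:
  assumes "autoequivalence C F G" "\<not> zero_object C Y"
  shows "\<not> zero_object C (fobj F Y)" "\<not> zero_object C (fobj G Y)"
proof -
  have lin: "klinear_functor C F" "klinear_functor C G"
    using assms(1) unfolding autoequivalence_def exact_functor_def by auto
  obtain \<theta> \<theta>' where "natural_iso C (comp_functor G F) id_functor \<theta>"
    "natural_iso C (comp_functor F G) id_functor \<theta>'"
    using assms(1) unfolding autoequivalence_def by blast
  then have "isomorphic C (fobj G (fobj F Y)) Y" "isomorphic C (fobj F (fobj G Y)) Y"
    unfolding natural_iso_def isomorphic_def comp_functor_def id_functor_def by auto
  then show "\<not> zero_object C (fobj F Y)" "\<not> zero_object C (fobj G Y)"
    using zero_object_functor lin zero_object_iso assms(2) by blast+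
qed

end

theorem proposition3p3:
  fixes C :: "('k::field, 'o, 'm::ab_group_add) tricat"
    and \<tau> :: "'o stability"
    and \<sigma> \<sigma>' :: "('o, 'm) endofunctor"
    and X Y :: 'o
  assumes "triangulated_category C"
    and "hom_finite C"
    and "two_calabi_yau C"
    and "stability_condition C \<tau>"
    and "spherical C X"
    and "stable_object C \<tau> X"
    and "\<And>X'. \<lbrakk>stable_object C \<tau> X'; phase \<tau> X' = phase \<tau> X\<rbrakk> \<Longrightarrow> isomorphic C X' X"
    and "spherical_twist C X \<sigma> \<sigma>'"
    and "\<not> zero_object C Y"
    and "\<And>i. i < 0 \<Longrightarrow> hom C i Y Y = {0}"
    and "phase_max C \<tau> Y - phase_min C \<tau> Y \<ge> 1"
  shows "(phase_min C \<tau> Y = phase \<tau> X \<longrightarrow>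
            phase_max C \<tau> Y \<ge> phase_max C \<tau> (fobj \<sigma>' Y)) \<and>
         (phase_max C \<tau> Y = phase \<tau> X \<longrightarrow>
            phase_min C \<tau> Y \<le> phase_min C \<tau> (fobj \<sigma> Y))"
proof -
  interpret triangulated_stability C \<tau>
    using assms(1,4) by (simp add: triangulated_stability_def triangulated_stability_axioms_def)
  have auto: "autoequivalence C \<sigma> \<sigma>'" using assms(8) unfolding spherical_twist_def by blast
  define \<phi> where "\<phi> = phase \<tau> X"
  have X: "X \<in> P \<phi>"
    using assms(6) phase_eq unfolding stable_object_def semistable_def \<phi>_def by metis
  have uniq: "isomorphic C D X" if "D \<in> P \<phi>" "\<not> zero_object C D" "stable_object C \<tau> D" for D
    using assms(7)[OF that(3)] phase_eq[OF that(1,2)] unfolding \<phi>_def by blast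
  have 1: "phase_max C \<tau> (fobj \<sigma>' Y) \<le> phase_max C \<tau> Y" if min: "phase_min C \<tau> Y = \<phi>"
  proof (rule phase_max_le[OF autoequivalence_nonzero(2)[OF auto assms(9)]])
    obtain E coev p r where ce: "coevaluation C X Y E coev" and T: "dist C (fobj \<sigma>' Y) Y E p coev r"
      using assms(8) unfolding spherical_twist_def by blast
    obtain B \<iota> \<pi> where B: "\<And>i. is_basis C (hom C i Y X) (B i)"
      and bp: "biproduct C (SIGMA i:UNIV. B i) (\<lambda>(i, b). sh C i X) E \<iota> \<pi>"
      using ce unfolding coevaluation_def by blast
    \<comment> \<open>Let m = 2 - i. If the bound fails, then m < phi^-(Y) + 1 - phi^+(Y) <= 0, as
      the vanishing lemma requires; duality then kills Hom^i(Y,X), which contains the nonzero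
      \<open>b\<close>.\<close>
    have bound: "\<phi> + i \<le> phase_max C \<tau> Y + 1" if "b \<in> B i" for i b
    proof (rule ccontr)
      assume "\<not> \<phi> + i \<le> phase_max C \<tau> Y + 1"
      then have "hom C (2 - i) X Y = {0}"
        using Hom_stable_to_shift_zero[OF assms(9,10), of "2 - i" X] uniq min assms(11) by simp
      then show False using two_calabi_yau_Hom_zero[OF assms(3)] is_basis_nonzero[OF B that] by blast
    qed
    show "phases_le C P (fobj \<sigma>' Y) (phase_max C \<tau> Y)"
      unfolding phases_le_def
    proof (intro allI impI ballI)
      fix s A assume s: "phase_max C \<tau> Y < s" and A: "A \<in> P s"
      \<comment> \<open>A[1] has phase s + 1, above every summand X[i] by \<open>bound\<close>; so a
        map into the inverse twist is determined by its composite with \<open>p\<close>.\<close>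
      have "Hom C (sh C 1 A) E = {0}"
      proof (rule Hom_biproduct_target[OF bp])
        fix x assume "x \<in> (SIGMA i:UNIV. B i)"
        then obtain i b where x: "x = (i, b)" "b \<in> B i" by auto
        have "\<phi> + i < s + 1" using bound[OF x(2)] s by simp
        then show "Hom C (sh C 1 A) (case x of (i, b) \<Rightarrow> sh C i X) = {0}"
          using Hom_slice_zero[OF _ sh_slice[OF A, of 1] sh_slice[OF X, of i]] x by simp
      qed
      moreover have "p \<cdot>\<^bsub>C\<^esub> a = 0" if "a \<in> Hom C A (fobj \<sigma>' Y)" for a
        using phases_leD[OF phases_le_phase_max[OF assms(9)] A s] cmp_Hom[OF that] dist_Hom[OF T] by blast
      ultimately have "a = 0" if "a \<in> Hom C A (fobj \<sigma>' Y)" for a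
        using dist_cancel_left[OF T that] that by blast
      then show "Hom C A (fobj \<sigma>' Y) = {0}" using zero_Hom by blast
    qed
  qed
  have 2: "phase_min C \<tau> Y \<le> phase_min C \<tau> (fobj \<sigma> Y)" if max: "phase_max C \<tau> Y = \<phi>"
  proof (rule phase_min_ge[OF autoequivalence_nonzero(1)[OF auto assms(9)]])
    obtain E ev q r where e: "evaluation C X Y E ev" and T: "dist C E Y (fobj \<sigma> Y) ev q r"
      using assms(8) unfolding spherical_twist_def by blast
    obtain B \<iota> \<pi> where B: "\<And>i. is_basis C (hom C i X Y) (B i)"
      and bp: "biproduct C (SIGMA i:UNIV. B i) (\<lambda>(i, b). sh C (- i) X) E \<iota> \<pi>"
      using e unfolding evaluation_def by blast
    \<comment> \<open>Failure now means 2 - i < phi^-(Y) + 1 - phi^+(Y), the same range of degrees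
      with phi(X) = phi^+(Y).\<close>
    have bound: "phase_min C \<tau> Y \<le> \<phi> + 1 - i" if "b \<in> B i" for i b
    proof (rule ccontr)
      assume "\<not> phase_min C \<tau> Y \<le> \<phi> + 1 - i"
      then have "hom C (2 - i) Y X = {0}"
        using Hom_to_shift_stable_zero[OF assms(9,10), of "2 - i" X] uniq max assms(11) by simp
      then show False using two_calabi_yau_Hom_zero[OF assms(3)] is_basis_nonzero[OF B that] by blast
    qed
    show "phases_ge C P (fobj \<sigma> Y) (phase_min C \<tau> Y)"
      unfolding phases_ge_def
    proof (intro allI impI ballI)
      fix s A assume s: "s < phase_min C \<tau> Y" and A: "A \<in> P s"
      \<comment> \<open>The biproduct decomposition belongs to \<open>E\<close> itself, so the shift
        is moved to the target before the summands X[-i] are compared with it.\<close>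
      have "Hom C (sh C 1 E) A = {0} \<longleftrightarrow> Hom C E (sh C (-1) A) = {0}"
        using Hom_sh_eq_zero_iff[of 1 E "sh C (-1) A"] sh_neg_sh(2)[of 1 A] by simp
      also have "Hom C E (sh C (-1) A) = {0}"
      proof (rule Hom_biproduct_source[OF bp])
        fix x assume "x \<in> (SIGMA i:UNIV. B i)"
        then obtain i b where x: "x = (i, b)" "b \<in> B i" by auto
        have "s - 1 < \<phi> - i" using bound[OF x(2)] s by simp
        then show "Hom C (case x of (i, b) \<Rightarrow> sh C (- i) X) (sh C (-1) A) = {0}"
          using Hom_slice_zero[OF _ sh_slice[OF X, of "- i"] sh_slice[OF A, of "-1"]] x by simp
      qed
      finally have "Hom C (sh C 1 E) A = {0}" by simp
      moreover have "a \<cdot>\<^bsub>C\<^esub> q = 0" if "a \<in> Hom C (fobj \<sigma> Y) A" for a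
        using phases_geD[OF phases_ge_phase_min[OF assms(9)] A s] cmp_Hom[OF _ that] dist_Hom[OF T] by blast
      ultimately have "a = 0" if "a \<in> Hom C (fobj \<sigma> Y) A" for a
        using dist_cancel_right[OF T that] that by blast
      then show "Hom C (fobj \<sigma> Y) A = {0}" using zero_Hom by blast
    qed
  qed
  show ?thesis using 1 2 unfolding \<phi>_def by blast
qed

end
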